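(* Let $s\in S$ be fixed and let $\mathscr{B}(j)=\mathcal{B}(s,2^{-j})$ for $j\in\mathbb{N}$. Assume the following. (i) There is a nonincreasing function $D:(0,1/4]\to[1,+\infty)$ such that, for every $x\in(0,1/4]$, every closed ball $B\subset S$ of radius $4x$ and every $x$-separated subset $N$ of $B$, one has $|N|\le\exp[D(x)]$; moreover $\overline{D}=\sup_{0<x\le1/4}D(x)<+\infty$. (ii) There are a nondecreasing function $\beta:\mathbb{N}\to[1,+\infty)$ and a number $\gamma\in[1,4)$ such that $$\nu(\mathscr{B}(j-k))\le\exp\left[\gamma^{k}\beta(j)\right]\nu(\mathscr{B}(j))\quad\text{for all integers } j\ge3 \text{ and } 3\le k\le j;$$ moreover $\overline{\beta}=\sup_{j\ge3}\beta(j)<+\infty$. Let $c\in(0,1/2]$ and assume that $$n\ge4^{4}\max\left\{\left(16c^{-2}n\right)^{(\log\gamma)/(\log4)}\,\overline{\beta}/3,\ \overline{D},\ \log(8/c)\right\}$$ and that the true distribution $P$ of the $X_i$ satisfies $h(P_s,P)=\kappa/\sqrt{2n}$ with $0\le\kappa<1/2$. For $x>0$, let $J_2(x)$ be the smallest positive integer $j$ such that $$4^{j-4}x^2\ge\max\left\{\gamma^{j+2}\,\overline{\beta}/3,\ \overline{D},\ \log(8/x)\right\}.$$ Then, with probability at least $1-(\kappa+c)$ with respect to $P^{\otimes n}$, $$\overline{\nu}\left[\left.\mathcal{B}\left(s,2^{k}c/\sqrt{n}\right)\right|\mathbf{X}\right]\ge1-1.05\exp\left[-4^{k-4}c^2\right]\quad\text{for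 all integers }k\ge J_2(c).$$
   Context: $\mathbb{N}=\{0,1,2,\dots\}$. $\mathbf{X}=(X_1,\dots,X_n)$ is a sample of $n$ i.i.d. random variables with values in a measurable space $\mathscr{X}$ and common distribution $P$. The Hellinger distance $h$ between probabilities $R,T$ on $\mathscr{X}$ is given by $h^2(R,T)=\frac12\int\left(\sqrt{dR/d\lambda}-\sqrt{dT/d\lambda}\right)^2d\lambda$, where $\lambda$ is any positive measure dominating $R$ and $T$ (so $h\le 1$). The model is a family $\{P_t\,|\,t\in S\}$ of probabilities on $\mathscr{X}$ with densities $f_t=dP_t/d\mu$ with respect to a reference measure $\mu$; the map $t\mapsto P_t$ is one-to-one, and $S$ is regarded as a metric space with distance $h(t,u)=h(P_t,P_u)$ and its Borel $\sigma$-algebra. The true distribution $P$ need not belong to the model. $\mathcal{B}(t,r)$ denotes the closed ball in $(S,h)$ with center $t$ and radius $r$. For $x>0$, a subset $N$ of a metric space is called $x$-separated if any two distinct points of $N$ are at distance larger than $x$; $|N|$ is the cardinality of $N$. The prior $\nu$ is a probability on $S$. For $\mathbf{x}=(x_1,\dots,x_n)\in\mathscr{X}^n$, $f_t(\mathbf{x})=\prod_{i=1}^nf_t(x_i)$. The map $(x,t)\mapsto f_t(x)$ is jointly measurable. The posterior distribution is $\overline{\nu}(A|\mathbf{X})=\int_Af_t(\mathbf{X})\,d\nu(t)\big/\int_Sf_t(\mathbf{X})\,d\nu(t)$ for measurable $A\subset S$ whenever the denominator lies in $(0,+\infty)$ (and an arbitrary fixed probability on $S$ otherwise). *)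

theory Defs
  imports "HOL-Probability.Probability"
begin

text \<open>The squared Hellinger distance does not depend on the dominating measure; the canonical
  choice \<open>R + T\<close> is taken in \<open>hellinger\<close>, and \<open>hellinger_density\<close> below gives
  the usual formula for densities with respect to an arbitrary measure.\<close>

definition sum_measure :: "'x measure \<Rightarrow> 'x measure \<Rightarrow> 'x measure" where
  "sum_measure R T = measure_of (space R) (sets R) (\<lambda>A. emeasure R A + emeasure T A)"

definition hellinger_wrt :: "'x measure \<Rightarrow> 'x measure \<Rightarrow> 'x measure \<Rightarrow> real" where
  "hellinger_wrt \<Lambda> R T =
     sqrt (1 / 2 * (\<integral>x. (sqrt (enn2real (RN_deriv \<Lambda> R x)) - sqrt (enn2real (RN_deriv \<Lambda> T x)))\<^sup>2 \<partial>\<Lambda>))"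

definition hellinger :: "'x measure \<Rightarrow> 'x measure \<Rightarrow> real" where
  "hellinger R T = hellinger_wrt (sum_measure R T) R T"

lemma sets_sum_measure [simp]: "sets (sum_measure R T) = sets R"
  and space_sum_measure [simp]: "space (sum_measure R T) = space R"
  unfolding sum_measure_def by (simp_all add: sets.sigma_sets_eq sets.space_closed)

lemma sum_measure_density:
  assumes [measurable]: "f \<in> borel_measurable M" "g \<in> borel_measurable M"
  shows "sum_measure (density M f) (density M g) = density M (\<lambda>x. f x + g x)"
proof -
  have *: "emeasure (density M f) A + emeasure (density M g) A = emeasure (density M (\<lambda>x. f x + g x)) A"
    if "A \<in> sets M" for A
    using that by (subst (1 2 3) emeasure_density) (auto simp: distrib_right nn_integral_add)
  have "sum_measure (density M f) (density M g)
      = measure_of (space M) (sets M) (emeasure (density M (\<lambda>x. f x + g x)))"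
    unfolding sum_measure_def space_density sets_density
    by (rule measure_of_eq[OF sets.space_closed]) (simp add: * sets.sigma_sets_eq)
  also have "\<dots> = density M (\<lambda>x. f x + g x)"
    using measure_of_of_measure[of "density M (\<lambda>x. f x + g x)"] by simp
  finally show ?thesis .
qed

lemma hellinger_density:
  fixes f g :: "'x \<Rightarrow> real"
  assumes [measurable]: "f \<in> borel_measurable M" "g \<in> borel_measurable M"
    and nonneg: "\<And>x. x \<in> space M \<Longrightarrow> 0 \<le> f x" "\<And>x. x \<in> space M \<Longrightarrow> 0 \<le> g x"
    and fin: "finite_measure (density M f)" "finite_measure (density M g)"
  shows "hellinger (density M f) (density M g) = sqrt (1 / 2 * (\<integral>x. (sqrt (f x) - sqrt (g x))\<^sup>2 \<partial>M))"
proof -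
  define h where "h = (\<lambda>x. f x + g x)"
  have [measurable]: "h \<in> borel_measurable M" unfolding h_def by simp
  have h0: "0 \<le> h x" if "x \<in> space M" for x using nonneg that by (simp add: h_def)
  define Q where "Q = density M (\<lambda>x. ennreal (h x))"
  have sum_eq: "sum_measure (density M f) (density M g) = Q"
    unfolding Q_def by (subst sum_measure_density) (auto intro!: density_cong simp: h_def nonneg)
  have "emeasure Q (space Q) = emeasure (density M f) (space M) + emeasure (density M g) (space M)"
    unfolding Q_def using nonneg
    by (simp add: emeasure_density h_def nn_integral_add[symmetric] cong: nn_integral_cong)
  also have "\<dots> < \<infinity>"
    using finite_measure.emeasure_finite[OF fin(1), of "space M"]
      finite_measure.emeasure_finite[OF fin(2), of "space M"]
    by (simp add: less_top)
  finally have "finite_measure Q" by (intro finite_measureI) simp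
  then interpret Q: finite_measure Q .
  have setsQ [simp, measurable_cong]: "sets Q = sets M" by (simp add: Q_def)
  have dens: "density Q (\<lambda>x. ennreal (k x / h x)) = density M k"
    if [measurable]: "k \<in> borel_measurable M" and k: "\<And>x. x \<in> space M \<Longrightarrow> 0 \<le> k x \<and> k x \<le> h x"
    for k :: "'x \<Rightarrow> real"
    unfolding Q_def
    by (subst density_density_eq)
       (use k h0 in \<open>force intro!: density_cong AE_I2 simp: ennreal_mult[symmetric]\<close>)+
  have RN: "AE x in Q. RN_deriv Q (density M k) x = ennreal (k x / h x)"
    if [measurable]: "k \<in> borel_measurable M" and k: "\<And>x. x \<in> space M \<Longrightarrow> 0 \<le> k x \<and> k x \<le> h x"
    for k :: "'x \<Rightarrow> real"
    using Q.RN_deriv_unique[OF _ dens[OF that]] by (auto elim!: eventually_mono)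
  have "(\<integral>x. (sqrt (enn2real (RN_deriv Q (density M f) x))
            - sqrt (enn2real (RN_deriv Q (density M g) x)))\<^sup>2 \<partial>Q)
      = (\<integral>x. (sqrt (f x / h x) - sqrt (g x / h x))\<^sup>2 \<partial>Q)"
  proof (rule integral_cong_AE)
    have "AE x in Q. x \<in> space M" using AE_space[of Q] by (simp add: Q_def)
    then show "AE x in Q. (sqrt (enn2real (RN_deriv Q (density M f) x))
            - sqrt (enn2real (RN_deriv Q (density M g) x)))\<^sup>2 = (sqrt (f x / h x) - sqrt (g x / h x))\<^sup>2"
      using RN[of f, simplified] RN[of g, simplified] nonneg h0
      by (auto simp: h_def elim!: eventually_elim2)
  qed (auto intro!: measurable_compose[OF borel_measurable_RN_deriv] borel_measurable_power
        borel_measurable_diff)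
  also have "\<dots> = (\<integral>x. h x * (sqrt (f x / h x) - sqrt (g x / h x))\<^sup>2 \<partial>M)"
    unfolding Q_def using h0 by (subst integral_density) auto
  also have "\<dots> = (\<integral>x. (sqrt (f x) - sqrt (g x))\<^sup>2 \<partial>M)"
  proof (rule Bochner_Integration.integral_cong[OF refl])
    fix x assume x: "x \<in> space M"
    show "h x * (sqrt (f x / h x) - sqrt (g x / h x))\<^sup>2 = (sqrt (f x) - sqrt (g x))\<^sup>2"
    proof (cases "h x = 0")
      case True
      then show ?thesis using nonneg[OF x] by (simp add: h_def add_nonneg_eq_0_iff)
    next
      case False
      then show ?thesis using h0[OF x]
        by (simp add: real_sqrt_divide diff_divide_distrib[symmetric] power_divide)
    qed
  qed
  finally show ?thesis unfolding hellinger_def hellinger_wrt_def sum_eq by simp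
qed

definition model :: "'x measure \<Rightarrow> ('t \<Rightarrow> 'x \<Rightarrow> real) \<Rightarrow> 't \<Rightarrow> 'x measure" where
  "model \<mu> f t = density \<mu> (\<lambda>x. ennreal (f t x))"

definition hdist :: "'x measure \<Rightarrow> ('t \<Rightarrow> 'x \<Rightarrow> real) \<Rightarrow> 't \<Rightarrow> 't \<Rightarrow> real" where
  "hdist \<mu> f t u = hellinger (model \<mu> f t) (model \<mu> f u)"

definition metric_borel :: "'t set \<Rightarrow> ('t \<Rightarrow> 't \<Rightarrow> real) \<Rightarrow> 't measure" where
  "metric_borel S d = sigma S {U. openin (Metric_space.mtopology S d) U}"

definition separated :: "('t \<Rightarrow> 't \<Rightarrow> real) \<Rightarrow> real \<Rightarrow> 't set \<Rightarrow> bool" where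
  "separated d x N \<longleftrightarrow> (\<forall>t\<in>N. \<forall>u\<in>N. t \<noteq> u \<longrightarrow> x < d t u)"

definition likelihood :: "('t \<Rightarrow> 'x \<Rightarrow> real) \<Rightarrow> nat \<Rightarrow> (nat \<Rightarrow> 'x) \<Rightarrow> 't \<Rightarrow> real" where
  "likelihood f n x t = (\<Prod>i<n. f t (x i))"

text \<open>The probability \<open>\<pi>\<^sub>0\<close> is the value of the posterior when the Bayes formula is undefined.\<close>

definition posterior ::
  "'t measure \<Rightarrow> 't measure \<Rightarrow> ('t \<Rightarrow> 'x \<Rightarrow> real) \<Rightarrow> nat \<Rightarrow> (nat \<Rightarrow> 'x) \<Rightarrow> 't set \<Rightarrow> real" where
  "posterior \<pi>\<^sub>0 \<nu> f n x A =
     (let Z = \<integral>\<^sup>+t\<in>space \<nu>. ennreal (likelihood f n x t) \<partial>\<nu>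
      in if 0 < Z \<and> Z < \<infinity>
         then enn2real ((\<integral>\<^sup>+t\<in>A. ennreal (likelihood f n x t) \<partial>\<nu>) / Z)
         else measure \<pi>\<^sub>0 A)"

definition J\<^sub>2 :: "real \<Rightarrow> real \<Rightarrow> real \<Rightarrow> real \<Rightarrow> nat" where
  "J\<^sub>2 \<gamma> \<beta>bar Dbar x =
     (LEAST j. 0 < j \<and>
        4 powr (real j - 4) * x\<^sup>2 \<ge> Max {\<gamma> ^ (j + 2) * \<beta>bar / 3, Dbar, ln (8 / x)})"

end

theory Submission
  imports Defs
begin

text \<open>Up to the factor \<open>f\<^sub>s(x)\<close>, the posterior mass of a set \<open>A\<close> of parameters is proportional to
\<open>evidence n A x\<close>, the integral over \<open>A\<close> of the likelihood ratio of \<open>t\<close> against \<open>s\<close>. If the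
observations have distribution \<open>P\<^sub>s\<close>, the expectation of the square root of this quantity
is a Hellinger affinity: that of the \<open>n\<close>-fold product of \<open>P\<^sub>s\<close> and the mixture, over
\<open>t \<in> A\<close>, of the \<open>n\<close>-fold products of the \<open>P\<^sub>t\<close>. The proof bounds these affinities and applies
Markov's inequality.

The numerator. Squared Hellinger distance to a fixed distribution is convex, so every
mixture of distributions from a Hellinger ball lies in the ball. If the centre
of the ball lies at distance at least \<open>r\<close> from \<open>s\<close> and its radius \<open>x\<close> is at most \<open>r / 2\<close>,
every such mixture has affinity at most \<open>1 - (r\<^sup>2 / 2 - x\<^sup>2) \<le> 1 - r\<^sup>2 / 4\<close> with \<open>P\<^sub>s\<close>
(\<open>mixture_affinity_le\<close>). Given the first observations, the next one again follows a
mixture over the same ball, with modified weights; hence the affinity for \<open>n\<close>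
observations is at most the \<open>n\<close>-th power (\<open>tensorized_mixture_affinity_le\<close>). The entropy
hypothesis covers the shell of the \<open>t\<close> with \<open>r < h(s,t) \<le> 2 r\<close> by at most \<open>exp Dbar\<close> balls of radius
at most \<open>r / 2\<close> (\<open>evidence_sqrt_shell_le\<close>).

The denominator. On a ball of radius \<open>\<epsilon>\<close> of order \<open>c / sqrt n\<close> around \<open>s\<close> the affinity is at
least \<open>(1 - \<epsilon>\<^sup>2) ^ n\<close>, so the evidence of this ball is unlikely to be much smaller than its
prior mass (\<open>evidence_lower_bound\<close>).

The balance. For \<open>r\<^sub>i = 2 ^ i * c / sqrt n\<close> write \<open>y\<^sub>i = 4 powr (i - 4) * c\<^sup>2\<close>, so that
\<open>n r\<^sub>i\<^sup>2 / 4 = 64 y\<^sub>i\<close>. From the index \<open>J\<^sub>2\<close> on, the number of covering balls is at most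
\<open>exp y\<^sub>i\<close> and the prior mass of the ball of radius \<open>2 r\<^sub>i\<close> is at most \<open>exp (12 y\<^sub>i)\<close> times
that of the ball of radius \<open>\<epsilon>\<close>. The factor \<open>exp (- 64 y\<^sub>i)\<close> outweighs both
and leaves \<open>exp (- y\<^sub>i)\<close> for the posterior mass of the shell and for the exceptional probability (\<open>evidence_concentration\<close>). As \<open>y\<^sub>i\<close> is multiplied
by four from one shell to the next, the sum over the shells is dominated by its first term.

Finally, replacing \<open>P\<^sub>s\<close> by the true distribution changes the probability of an event by at
most the total variation distance of the product measures, which is bounded by
\<open>sqrt (2 * n) * h(P\<^sub>s, P) = \<kappa>\<close> (\<open>product_measure_TV_le\<close>).\<close>

section \<open>Square roots of extended nonnegative reals\<close>

text \<open>With the value \<open>\<top>\<close> at \<open>\<top>\<close> the square root is monotone and multiplicative on all extended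
nonnegative reals, so that affinities can be written and estimated as nonnegative integrals
before anything is known about finiteness.\<close>

definition esqrt :: "ennreal \<Rightarrow> ennreal" where
  "esqrt x = (if x = \<top> then \<top> else ennreal (sqrt (enn2real x)))"

lemma esqrt_ennreal [simp]: "0 \<le> x \<Longrightarrow> esqrt (ennreal x) = ennreal (sqrt x)"
  by (simp add: esqrt_def)

lemma esqrt_top [simp]: "esqrt \<top> = \<top>"
  and esqrt_0 [simp]: "esqrt 0 = 0"
  and esqrt_1 [simp]: "esqrt 1 = 1"
  by (simp_all add: esqrt_def)

lemma esqrt_mult_self [simp]: "esqrt x * esqrt x = x"
  by (cases x) (simp_all add: ennreal_mult[symmetric])

lemma esqrt_power2 [simp]: "(esqrt x)\<^sup>2 = x"
  by (simp add: power2_eq_square)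

lemma esqrt_mono: "x \<le> y \<Longrightarrow> esqrt x \<le> esqrt y"
  by (cases x; cases y) (auto simp: top_unique)

lemma esqrt_mult: "esqrt (x * y) = esqrt x * esqrt y"
  by (cases x; cases y)
     (auto simp: ennreal_mult[symmetric] real_sqrt_mult ennreal_mult_top ennreal_top_mult)

lemma esqrt_square [simp]: "esqrt (x\<^sup>2) = x"
  by (simp add: power2_eq_square esqrt_mult)

lemma esqrt_prod: "esqrt (\<Prod>i\<in>I. x i) = (\<Prod>i\<in>I. esqrt (x i))"
  by (induction I rule: infinite_finite_induct) (auto simp: esqrt_mult)

lemma esqrt_eq_0_iff [simp]: "esqrt x = 0 \<longleftrightarrow> x = 0"
  by (metis esqrt_0 esqrt_mult_self mult_zero_left)

lemma esqrt_eq_top_iff [simp]: "esqrt x = \<top> \<longleftrightarrow> x = \<top>"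
  by (simp add: esqrt_def)

lemma esqrt_add_le: "esqrt (x + y) \<le> esqrt x + esqrt y"
  by (cases x; cases y) (auto simp flip: ennreal_plus simp: sqrt_add_le_add_sqrt)

lemma esqrt_sum_le: "esqrt (\<Sum>i\<in>I. x i) \<le> (\<Sum>i\<in>I. esqrt (x i))"
proof (induction I rule: infinite_finite_induct)
  case (insert i I)
  then show ?case
    using esqrt_add_le[of "x i" "\<Sum>i\<in>I. x i"] by (auto intro: order_trans add_left_mono)
qed auto

lemma measurable_esqrt [measurable]: "esqrt \<in> borel_measurable borel"
  unfolding esqrt_def[abs_def] by measurable

lemma nn_integral_esqrt_mult_le:
  assumes [measurable]: "f \<in> borel_measurable M" "g \<in> borel_measurable M"
  shows "(\<integral>\<^sup>+x. esqrt (f x) * esqrt (g x) \<partial>M) \<le> esqrt (\<integral>\<^sup>+x. f x \<partial>M) * esqrt (\<integral>\<^sup>+x. g x \<partial>M)"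
proof -
  have "(\<integral>\<^sup>+x. esqrt (f x) * esqrt (g x) \<partial>M)\<^sup>2 \<le> (\<integral>\<^sup>+x. f x \<partial>M) * (\<integral>\<^sup>+x. g x \<partial>M)"
    using Cauchy_Schwarz_nn_integral[of "\<lambda>x. esqrt (f x)" M "\<lambda>x. esqrt (g x)"] by simp
  from esqrt_mono[OF this] show ?thesis by (simp add: esqrt_mult)
qed

section \<open>Hellinger affinity\<close>

lemma sqrt_diff_square_le:
  assumes "0 \<le> x" "0 \<le> y" shows "(sqrt x - sqrt y)\<^sup>2 \<le> x + y"
  using assms by (simp add: power2_diff)

lemma integrable_sqrt_diff_square:
  fixes f g :: "'x \<Rightarrow> real"
  assumes f: "integrable M f" and g: "integrable M g"
    and nonneg: "\<And>x. x \<in> space M \<Longrightarrow> 0 \<le> f x" "\<And>x. x \<in> space M \<Longrightarrow> 0 \<le> g x"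
  shows "integrable M (\<lambda>x. (sqrt (f x) - sqrt (g x))\<^sup>2)"
proof (rule Bochner_Integration.integrable_bound[of _ "\<lambda>x. f x + g x"])
  show "(\<lambda>x. (sqrt (f x) - sqrt (g x))\<^sup>2) \<in> borel_measurable M"
    using borel_measurable_integrable[OF f] borel_measurable_integrable[OF g] by measurable
qed (use assms in \<open>auto intro!: AE_I2 sqrt_diff_square_le\<close>)

lemma integrable_prob_density:
  fixes f :: "'x \<Rightarrow> real"
  assumes f: "f \<in> borel_measurable M" "\<And>x. x \<in> space M \<Longrightarrow> 0 \<le> f x"
    and p: "prob_space (density M f)"
  shows "integrable M f" "(\<integral>x. f x \<partial>M) = 1" "(\<integral>\<^sup>+x. f x \<partial>M) = 1"
proof -
  show *: "(\<integral>\<^sup>+x. f x \<partial>M) = 1"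
    using prob_space.emeasure_space_1[OF p] f(1) 
    by (simp add: emeasure_density cong: nn_integral_cong)
  show "integrable M f"
    by (rule integrableI_nonneg) (use f * in auto)
  show "(\<integral>x. f x \<partial>M) = 1"
    by (rule integral_eq_nn_integral[THEN trans]) (use f * in auto)
qed

text \<open>Expanding the square gives \<open>(sqrt f - sqrt g)\<^sup>2 = f + g - 2 * sqrt (f * g)\<close>, and \<open>f\<close> and \<open>g\<close> have
integral one.\<close>

lemma affinity_eq:
  fixes f g :: "'x \<Rightarrow> real"
  assumes f [measurable]: "f \<in> borel_measurable M" and f0: "\<And>x. x \<in> space M \<Longrightarrow> 0 \<le> f x"
    and g [measurable]: "g \<in> borel_measurable M" and g0: "\<And>x. x \<in> space M \<Longrightarrow> 0 \<le> g x"
    and fp: "prob_space (density M f)" and gp: "prob_space (density M g)"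
    and H: "H = sqrt (1 / 2 * (\<integral>x. (sqrt (f x) - sqrt (g x))\<^sup>2 \<partial>M))"
  shows "(\<integral>\<^sup>+x. esqrt (ennreal (f x) * ennreal (g x)) \<partial>M) = ennreal (1 - H\<^sup>2)"
    and "0 \<le> H" "H \<le> 1"
proof -
  note F = integrable_prob_density[OF f f0 fp] and G = integrable_prob_density[OF g g0 gp]
  note I = integrable_sqrt_diff_square[OF F(1) G(1) f0 g0]
  define K where "K = (\<integral>x. (sqrt (f x) - sqrt (g x))\<^sup>2 \<partial>M)"
  have K0: "0 \<le> K" unfolding K_def by simp
  then show "0 \<le> H" by (simp add: H K_def)
  have H2: "H\<^sup>2 = K / 2" using K0 by (simp add: H flip: K_def)
  have "(\<integral>x. f x + g x - (sqrt (f x) - sqrt (g x))\<^sup>2 \<partial>M) = 2 - K"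
    using F G I by (simp add: K_def)
  moreover have eq: "f x + g x - (sqrt (f x) - sqrt (g x))\<^sup>2 = 2 * sqrt (f x * g x)"
    if "x \<in> space M" for x using f0[OF that] g0[OF that] by (simp add: power2_diff real_sqrt_mult)
  moreover have "integrable M (\<lambda>x. f x + g x - (sqrt (f x) - sqrt (g x))\<^sup>2)"
    using F G I by simp
  ultimately have *: "integrable M (\<lambda>x. sqrt (f x * g x))" "2 * (\<integral>x. sqrt (f x * g x) \<partial>M) = 2 - K"
    by (simp_all cong: Bochner_Integration.integrable_cong Bochner_Integration.integral_cong)
  have "0 \<le> (\<integral>x. sqrt (f x * g x) \<partial>M)" using f0 g0 by (auto intro!: Bochner_Integration.integral_nonneg)
  with * have "H\<^sup>2 \<le> 1" by (simp add: H2)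
  then show "H \<le> 1" by (simp add: power_le_one_iff \<open>0 \<le> H\<close> abs_square_le_1)
  have "(\<integral>\<^sup>+x. esqrt (ennreal (f x) * ennreal (g x)) \<partial>M) = (\<integral>\<^sup>+x. ennreal (sqrt (f x * g x)) \<partial>M)"
    using f0 g0 by (intro nn_integral_cong) (simp add: ennreal_mult[symmetric])
  also have "\<dots> = ennreal (\<integral>x. sqrt (f x * g x) \<partial>M)"
    by (rule nn_integral_eq_integral[OF *(1)]) (use f0 g0 in auto)
  also have "(\<integral>x. sqrt (f x * g x) \<partial>M) = 1 - H\<^sup>2" using *(2) by (simp add: H2)
  finally show "(\<integral>\<^sup>+x. esqrt (ennreal (f x) * ennreal (g x)) \<partial>M) = ennreal (1 - H\<^sup>2)" .
qed

lemma hellinger_affinity: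
  fixes f g :: "'x \<Rightarrow> real"
  assumes f: "f \<in> borel_measurable M" "\<And>x. x \<in> space M \<Longrightarrow> 0 \<le> f x" "prob_space (density M f)"
    and g: "g \<in> borel_measurable M" "\<And>x. x \<in> space M \<Longrightarrow> 0 \<le> g x" "prob_space (density M g)"
  shows "(\<integral>\<^sup>+x. esqrt (ennreal (f x) * ennreal (g x)) \<partial>M)
      = ennreal (1 - (hellinger (density M f) (density M g))\<^sup>2)"
    and "0 \<le> hellinger (density M f) (density M g)"
    and "hellinger (density M f) (density M g) \<le> 1"
  using affinity_eq[OF f(1,2) g(1,2) f(3) g(3) hellinger_density] assms
  by (auto simp: prob_space.finite_measure)

section \<open>Total variation between product measures\<close>

lemma finite_measure_sum_measure:
  assumes R: "prob_space R" and T: "prob_space T" and RT: "sets R = sets T"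
  shows "emeasure (sum_measure R T) A = (if A \<in> sets R then emeasure R A + emeasure T A else 0)"
    and "finite_measure (sum_measure R T)"
proof -
  have ca: "countably_additive (sets R) (\<lambda>A. emeasure R A + emeasure T A)"
    unfolding countably_additive_def
    using RT by (auto simp: suminf_add[symmetric] suminf_emeasure)
  have *: "emeasure (sum_measure R T) A = emeasure R A + emeasure T A" if "A \<in> sets R" for A
    unfolding sum_measure_def
    by (rule emeasure_measure_of_sigma[OF sets.sigma_algebra_axioms _ ca that])
       (simp add: positive_def)
  then show "emeasure (sum_measure R T) A = (if A \<in> sets R then emeasure R A + emeasure T A else 0)"
    by (simp add: emeasure_notin_sets)
  have "space R = space T" using RT by (rule sets_eq_imp_space_eq)
  then have "emeasure (sum_measure R T) (space R) = 2"
    using *[OF sets.top] prob_space.emeasure_space_1[OF R] prob_space.emeasure_space_1[OF T] by simp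
  then show "finite_measure (sum_measure R T)"
    by (intro finite_measureI) simp
qed

text \<open>Two probabilities without given densities have densities with respect to their
sum, and the definition of the distance uses exactly these; the Radon--Nikodym derivatives are
finite almost everywhere and may be replaced by real functions.\<close>

lemma hellinger_common_densities:
  assumes R: "prob_space R" and T: "prob_space T" and RT: "sets R = sets T"
  obtains Q :: "'x measure" and a b :: "'x \<Rightarrow> real" where
    "finite_measure Q" "sets Q = sets R"
    "a \<in> borel_measurable Q" "\<And>x. 0 \<le> a x" "R = density Q a"
    "b \<in> borel_measurable Q" "\<And>x. 0 \<le> b x" "T = density Q b"
    "(\<integral>\<^sup>+x. esqrt (ennreal (a x) * ennreal (b x)) \<partial>Q) = ennreal (1 - (hellinger R T)\<^sup>2)"
    "0 \<le> hellinger R T" "hellinger R T \<le> 1"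
proof -
  define Q where "Q = sum_measure R T"
  note sm = finite_measure_sum_measure[OF R T RT]
  interpret Q: finite_measure Q unfolding Q_def by (rule sm)
  have dens: "density Q (\<lambda>x. ennreal (enn2real (RN_deriv Q K x))) = K"
    if K: "prob_space K" "sets K = sets R" "\<And>A. emeasure K A \<le> emeasure Q A" for K
  proof -
    have ac: "absolutely_continuous Q K"
    proof -
      have "emeasure K A = 0" if "emeasure Q A = 0" for A
        using K(3)[of A] that by simp
      then show ?thesis using K(2) by (auto simp: absolutely_continuous_def null_sets_def Q_def)
    qed
    have sK: "sets K = sets Q" using K(2) by (simp add: Q_def)
    have fin: "AE x in Q. RN_deriv Q K x \<noteq> \<infinity>"
      by (intro Q.RN_deriv_finite[OF _ ac sK] prob_space_imp_sigma_finite K)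
    have "density Q (\<lambda>x. ennreal (enn2real (RN_deriv Q K x))) = density Q (RN_deriv Q K)"
      by (rule density_cong) (use fin in \<open>auto elim!: eventually_mono simp: less_top\<close>)
    also have "\<dots> = K" by (rule Q.density_RN_deriv[OF ac sK])
    finally show ?thesis .
  qed
  let ?a = "\<lambda>x. enn2real (RN_deriv Q R x)" and ?b = "\<lambda>x. enn2real (RN_deriv Q T x)"
  have dR: "R = density Q ?a" using R sm(1) by (intro dens[symmetric]) (auto simp: Q_def emeasure_notin_sets)
  have dT: "T = density Q ?b" using T sm(1) RT
    by (intro dens[symmetric]) (auto simp: Q_def emeasure_notin_sets)
  have H: "hellinger R T = sqrt (1 / 2 * (\<integral>x. (sqrt (?a x) - sqrt (?b x))\<^sup>2 \<partial>Q))"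
    by (simp add: hellinger_def hellinger_wrt_def Q_def)
  have "prob_space (density Q ?a)" "prob_space (density Q ?b)"
    using R T dR dT by simp_all
  note aff = affinity_eq[OF _ _ _ _ this H]
  show thesis
    by (rule that[of Q ?a ?b]) (use dR dT aff Q.finite_measure_axioms in \<open>auto simp: Q_def\<close>)
qed

lemma PiM_density:
  fixes I :: "'i set" and a :: "'x \<Rightarrow> real"
  assumes I: "finite I" and Q: "sigma_finite_measure Q"
    and [measurable]: "a \<in> borel_measurable Q" and p: "sigma_finite_measure (density Q a)"
  shows "(\<Pi>\<^sub>M i\<in>I. density Q a) = density (\<Pi>\<^sub>M i\<in>I. Q) (\<lambda>x. \<Prod>i\<in>I. ennreal (a (x i)))"
proof (rule sym)
  interpret Q: product_sigma_finite "\<lambda>_::'i. Q" by (rule product_sigma_finite.intro) (rule Q)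
  interpret R: product_sigma_finite "\<lambda>_::'i. density Q a"
    by (rule product_sigma_finite.intro) (rule p)
  show "density (\<Pi>\<^sub>M i\<in>I. Q) (\<lambda>x. \<Prod>i\<in>I. ennreal (a (x i))) = (\<Pi>\<^sub>M i\<in>I. density Q a)"
  proof (rule R.PiM_eqI[OF I])
    show "sets (density (\<Pi>\<^sub>M i\<in>I. Q) (\<lambda>x. \<Prod>i\<in>I. ennreal (a (x i)))) = sets (\<Pi>\<^sub>M i\<in>I. density Q a)"
      by (simp cong: sets_PiM_cong)
    fix A :: "'i \<Rightarrow> 'x set" assume "\<And>i. i \<in> I \<Longrightarrow> A i \<in> sets (density Q a)"
    then have A [measurable]: "\<And>i. i \<in> I \<Longrightarrow> A i \<in> sets Q" by simp
    have PA: "Pi\<^sub>E I A \<in> sets (\<Pi>\<^sub>M i\<in>I. Q)" using I A by (intro sets_PiM_I_finite) auto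
    have "emeasure (density (\<Pi>\<^sub>M i\<in>I. Q) (\<lambda>x. \<Prod>i\<in>I. ennreal (a (x i)))) (Pi\<^sub>E I A)
      = (\<integral>\<^sup>+x. (\<Prod>i\<in>I. ennreal (a (x i))) * indicator (Pi\<^sub>E I A) x \<partial>(\<Pi>\<^sub>M i\<in>I. Q))"
      by (rule emeasure_density[OF _ PA]) measurable
    also have "\<dots> = (\<integral>\<^sup>+x. (\<Prod>i\<in>I. ennreal (a (x i)) * indicator (A i) (x i)) \<partial>(\<Pi>\<^sub>M i\<in>I. Q))"
    proof (rule nn_integral_cong)
      fix x assume "x \<in> space (\<Pi>\<^sub>M i\<in>I. Q)"
      then have "indicator (Pi\<^sub>E I A) x = (\<Prod>i\<in>I. indicator (A i) (x i) :: ennreal)"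
        using I by (auto simp: indicator_def space_PiM PiE_def Pi_iff prod_eq_1_iff split: if_splits)
      then show "(\<Prod>i\<in>I. ennreal (a (x i))) * indicator (Pi\<^sub>E I A) x
          = (\<Prod>i\<in>I. ennreal (a (x i)) * indicator (A i) (x i))" by (simp add: prod.distrib)
    qed
    also have "\<dots> = (\<Prod>i\<in>I. \<integral>\<^sup>+x. ennreal (a x) * indicator (A i) x \<partial>Q)"
      by (rule Q.product_nn_integral_prod[OF I]) (use A in measurable)
    also have "\<dots> = (\<Prod>i\<in>I. emeasure (density Q a) (A i))"
      using A by (intro prod.cong) (auto simp: emeasure_density)
    finally show "emeasure (density (\<Pi>\<^sub>M i\<in>I. Q) (\<lambda>x. \<Prod>i\<in>I. ennreal (a (x i)))) (Pi\<^sub>E I A)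
      = (\<Prod>i\<in>I. emeasure (density Q a) (A i))" .
  qed
qed

text \<open>The right-hand side of the last hypothesis is the affinity of the distributions \<open>(u, 1 - u)\<close> and
\<open>(v, 1 - v)\<close>. For \<open>u = (cos a)\<^sup>2\<close> and \<open>v = (cos b)\<^sup>2\<close> it equals \<open>cos (a - b)\<close>, while
\<open>u - v = sin (a + b) * sin (b - a)\<close>.\<close>

lemma two_point_affinity_bound:
  fixes u v \<rho> :: real
  assumes u: "0 \<le> u" "u \<le> 1" and v: "0 \<le> v" "v \<le> 1" and \<rho>: "0 \<le> \<rho>"
    and le: "\<rho> \<le> sqrt u * sqrt v + sqrt (1 - u) * sqrt (1 - v)"
  shows "(u - v)\<^sup>2 \<le> 1 - \<rho>\<^sup>2"
proof -
  define p q r t where "p = sqrt u" and "q = sqrt v" and "r = sqrt (1 - u)" and "t = sqrt (1 - v)"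
  have sq: "p\<^sup>2 = u" "q\<^sup>2 = v" "r\<^sup>2 = 1 - u" "t\<^sup>2 = 1 - v"
    using u v by (auto simp: p_def q_def r_def t_def)
  have "\<rho>\<^sup>2 \<le> (p * q + r * t)\<^sup>2"
    using le \<rho> by (intro power_mono) (auto simp: p_def q_def r_def t_def)
  also have "\<dots> = p\<^sup>2 * q\<^sup>2 + r\<^sup>2 * t\<^sup>2 + 2 * (p * r) * (q * t)"
    by (simp add: power2_eq_square algebra_simps)
  also have "2 * (p * r) * (q * t) \<le> (p * r)\<^sup>2 + (q * t)\<^sup>2" by (rule sum_squares_bound)
  also have "p\<^sup>2 * q\<^sup>2 + r\<^sup>2 * t\<^sup>2 + ((p * r)\<^sup>2 + (q * t)\<^sup>2) = 1 - (u - v)\<^sup>2"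
    unfolding power_mult_distrib sq by (simp add: power2_eq_square algebra_simps)
  finally show ?thesis by simp
qed

text \<open>By Cauchy--Schwarz on \<open>A\<close> and on its complement, the affinity of the two product measures
is at most that of the two-point distributions which they induce through the indicator of \<open>A\<close>.
Affinities of products multiply, so this affinity is \<open>(1 - h\<^sup>2) ^ n\<close>, and Bernoulli's
inequality turns it into a bound of order \<open>sqrt n * h\<close>.\<close>

lemma product_measure_TV_le:
  assumes R: "prob_space R" and T: "prob_space T" and RT: "sets R = sets T"
    and A: "A \<in> sets (\<Pi>\<^sub>M i\<in>{..<n}. R)"
  shows "\<bar>measure (\<Pi>\<^sub>M i\<in>{..<n}. R) A - measure (\<Pi>\<^sub>M i\<in>{..<n}. T) A\<bar> \<le> sqrt (2 * real n) * hellinger R T"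
proof -
  obtain Q :: "'a measure" and a b where Q: "finite_measure Q" "sets Q = sets R"
    and a [measurable]: "a \<in> borel_measurable Q" and a0: "\<And>x. 0 \<le> a x" and Ra: "R = density Q a"
    and b [measurable]: "b \<in> borel_measurable Q" and b0: "\<And>x. 0 \<le> b x" and Tb: "T = density Q b"
    and aff: "(\<integral>\<^sup>+x. esqrt (ennreal (a x) * ennreal (b x)) \<partial>Q) = ennreal (1 - (hellinger R T)\<^sup>2)"
    and h: "0 \<le> hellinger R T" "hellinger R T \<le> 1"
    by (rule hellinger_common_densities[OF R T RT]) blast
  interpret Q: finite_measure Q by fact
  define h where "h = hellinger R T"
  have h2: "0 \<le> h\<^sup>2" "h\<^sup>2 \<le> 1" using h by (auto simp: h_def power_le_one)
  let ?Q = "\<Pi>\<^sub>M i\<in>{..<n}. Q" and ?R = "\<Pi>\<^sub>M i\<in>{..<n}. R" and ?T = "\<Pi>\<^sub>M i\<in>{..<n}. T"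
  interpret PQ: product_sigma_finite "\<lambda>_::nat. Q" by (rule product_sigma_finite.intro) unfold_locales
  interpret PR: prob_space ?R by (rule prob_space_PiM) (rule R)
  interpret PT: prob_space ?T by (rule prob_space_PiM) (rule T)
  define \<alpha> \<beta> where "\<alpha> = (\<lambda>x. \<Prod>i<n. ennreal (a (x i)))" and "\<beta> = (\<lambda>x. \<Prod>i<n. ennreal (b (x i)))"
  have [measurable]: "\<alpha> \<in> borel_measurable ?Q" "\<beta> \<in> borel_measurable ?Q"
    unfolding \<alpha>_def \<beta>_def by measurable
  have Rd: "?R = density ?Q \<alpha>" unfolding Ra \<alpha>_def
    by (rule PiM_density) (use R in \<open>auto simp: Ra prob_space_imp_sigma_finite Q.sigma_finite_measure_axioms\<close>)
  have Td: "?T = density ?Q \<beta>" unfolding Tb \<beta>_def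
    by (rule PiM_density) (use T in \<open>auto simp: Tb prob_space_imp_sigma_finite Q.sigma_finite_measure_axioms\<close>)
  have [measurable]: "A \<in> sets ?Q" using A by (simp add: Rd)
  have part: "(\<integral>\<^sup>+x. esqrt (\<alpha> x * \<beta> x) * indicator B x \<partial>?Q)
      \<le> ennreal (sqrt (measure ?R B) * sqrt (measure ?T B))" if [measurable]: "B \<in> sets ?Q" for B
  proof -
    have "(\<integral>\<^sup>+x. esqrt (\<alpha> x * \<beta> x) * indicator B x \<partial>?Q)
       = (\<integral>\<^sup>+x. esqrt (\<alpha> x * indicator B x) * esqrt (\<beta> x * indicator B x) \<partial>?Q)"
      by (intro nn_integral_cong) (auto simp: indicator_def esqrt_mult)
    also have "\<dots> \<le> esqrt (\<integral>\<^sup>+x. \<alpha> x * indicator B x \<partial>?Q) * esqrt (\<integral>\<^sup>+x. \<beta> x * indicator B x \<partial>?Q)"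
      by (rule nn_integral_esqrt_mult_le) measurable
    also have "\<dots> = esqrt (emeasure ?R B) * esqrt (emeasure ?T B)"
      by (simp add: Rd Td emeasure_density)
    also have "\<dots> = ennreal (sqrt (measure ?R B) * sqrt (measure ?T B))"
      by (simp add: PR.emeasure_eq_measure PT.emeasure_eq_measure ennreal_mult)
    finally show ?thesis .
  qed
  define u v where "u = measure ?R A" and "v = measure ?T A"
  have AR: "A \<in> sets ?R" "A \<in> sets ?T" by (simp_all add: Rd Td)
  have sp: "space ?R = space ?Q" "space ?T = space ?Q" by (simp_all add: Rd Td)
  have c: "measure ?R (space ?Q - A) = 1 - u" "measure ?T (space ?Q - A) = 1 - v"
    using PR.prob_compl[OF AR(1)] PT.prob_compl[OF AR(2)] by (simp_all add: sp u_def v_def)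
  have "ennreal ((1 - h\<^sup>2) ^ n) = (\<integral>\<^sup>+x. esqrt (\<alpha> x * \<beta> x) \<partial>?Q)"
  proof -
    have "(\<integral>\<^sup>+x. esqrt (\<alpha> x * \<beta> x) \<partial>?Q)
        = (\<integral>\<^sup>+x. (\<Prod>i<n. esqrt (ennreal (a (x i)) * ennreal (b (x i)))) \<partial>?Q)"
      by (simp add: \<alpha>_def \<beta>_def prod.distrib[symmetric] esqrt_prod)
    also have "\<dots> = (\<Prod>i<n. \<integral>\<^sup>+x. esqrt (ennreal (a x) * ennreal (b x)) \<partial>Q)"
      by (rule PQ.product_nn_integral_prod) auto
    also have "\<dots> = ennreal ((1 - h\<^sup>2) ^ n)" using h2 by (simp add: aff h_def ennreal_power)
    finally show ?thesis by simp
  qed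
  also have "\<dots> = (\<integral>\<^sup>+x. esqrt (\<alpha> x * \<beta> x) * indicator A x + esqrt (\<alpha> x * \<beta> x) * indicator (space ?Q - A) x \<partial>?Q)"
    by (intro nn_integral_cong) (auto simp: indicator_def)
  also have "\<dots> = (\<integral>\<^sup>+x. esqrt (\<alpha> x * \<beta> x) * indicator A x \<partial>?Q)
      + (\<integral>\<^sup>+x. esqrt (\<alpha> x * \<beta> x) * indicator (space ?Q - A) x \<partial>?Q)"
    by (rule nn_integral_add) auto
  also have "\<dots> \<le> ennreal (sqrt u * sqrt v) + ennreal (sqrt (1 - u) * sqrt (1 - v))"
    unfolding u_def v_def c[unfolded u_def v_def, symmetric] by (intro add_mono part) auto
  also have "\<dots> = ennreal (sqrt u * sqrt v + sqrt (1 - u) * sqrt (1 - v))"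
    by (subst ennreal_plus) (auto simp: u_def v_def)
  finally have "(1 - h\<^sup>2) ^ n \<le> sqrt u * sqrt v + sqrt (1 - u) * sqrt (1 - v)"
    by (subst (asm) ennreal_le_iff) (auto simp: u_def v_def)
  then have "(u - v)\<^sup>2 \<le> 1 - ((1 - h\<^sup>2) ^ n)\<^sup>2"
    using h2 by (intro two_point_affinity_bound) (auto simp: u_def v_def)
  also have "\<dots> \<le> 2 * real n * h\<^sup>2"
    using Bernoulli_inequality[of "- h\<^sup>2" "2 * n"] h2 by (simp add: power_mult mult.commute)
  also have "\<dots> = (sqrt (2 * real n) * h)\<^sup>2" by (simp add: power_mult_distrib)
  finally have "\<bar>u - v\<bar> \<le> sqrt (2 * real n) * h"
    by (rule power2_le_imp_le[of "\<bar>u - v\<bar>", simplified]) (use h in \<open>simp_all add: h_def\<close>)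
  then show ?thesis by (simp add: u_def v_def h_def)
qed

section \<open>Affinity between a distribution and a mixture\<close>

lemma ennreal_sum_squares_bound: "2 * x * y \<le> x\<^sup>2 + y\<^sup>2" for x y :: ennreal
proof (cases x; cases y)
  fix a b assume "x = ennreal a" "0 \<le> a" "y = ennreal b" "0 \<le> b"
  then show ?thesis using sum_squares_bound[of a b]
    by (simp add: ennreal_mult[symmetric] ennreal_power ennreal_numeral[symmetric] flip: ennreal_plus del: ennreal_numeral)
qed (auto simp: ennreal_mult_top ennreal_top_mult power2_eq_square)

text \<open>Let \<open>F\<close> be the mixture of the densities \<open>\<phi> t\<close> with weights \<open>w\<close>, say of total weight one. With
\<open>a = sqrt p\<close>, \<open>b = sqrt q\<close> and \<open>c = sqrt F\<close>, the inequality \<open>4 * a * c + 4 * b * c \<le> (a + b)\<^sup>2 + 4 * c\<^sup>2\<close>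
compares \<open>c\<close> with the midpoint of \<open>a\<close> and \<open>b\<close>; integrated, it says that the affinities of \<open>F\<close> with \<open>p\<close>
and with \<open>q\<close> add up to at most \<open>2 - h\<^sup>2 / 2\<close>. The affinity with \<open>q\<close> is at least \<open>1 - x\<^sup>2\<close>, because this holds
for every component and the square root is concave. What remains for \<open>p\<close> is
\<open>1 - (h\<^sup>2 / 2 - x\<^sup>2)\<close>. The weights are left unnormalised, since the induction over the
sample size multiplies them by likelihoods.\<close>

lemma mixture_affinity_le:
  fixes p q :: "'x \<Rightarrow> ennreal" and \<phi> :: "'t \<Rightarrow> 'x \<Rightarrow> ennreal" and w :: "'t \<Rightarrow> ennreal"
  assumes Q: "sigma_finite_measure Q" and N: "sigma_finite_measure N"
    and [measurable]: "p \<in> borel_measurable Q" "q \<in> borel_measurable Q" "w \<in> borel_measurable N"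
    and \<phi> [measurable]: "(\<lambda>(y, t). \<phi> t y) \<in> borel_measurable (Q \<Otimes>\<^sub>M N)"
    and p1: "(\<integral>\<^sup>+y. p y \<partial>Q) \<le> 1" and q1: "(\<integral>\<^sup>+y. q y \<partial>Q) \<le> 1"
    and pq: "(\<integral>\<^sup>+y. esqrt (p y * q y) \<partial>Q) \<le> ennreal (1 - h\<^sup>2)"
    and \<phi>1: "\<And>t. t \<in> space N \<Longrightarrow> w t \<noteq> 0 \<Longrightarrow> (\<integral>\<^sup>+y. \<phi> t y \<partial>Q) \<le> 1"
    and \<phi>q: "\<And>t. t \<in> space N \<Longrightarrow> w t \<noteq> 0 \<Longrightarrow> ennreal (1 - x\<^sup>2) \<le> (\<integral>\<^sup>+y. esqrt (q y * \<phi> t y) \<partial>Q)"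
    and h: "h\<^sup>2 \<le> 1" and x: "x\<^sup>2 \<le> 1"
  shows "(\<integral>\<^sup>+y. esqrt (p y * (\<integral>\<^sup>+t. \<phi> t y * w t \<partial>N)) \<partial>Q)
      \<le> ennreal (1 - (h\<^sup>2 / 2 - x\<^sup>2)) * esqrt (\<integral>\<^sup>+t. w t \<partial>N)"
proof -
  interpret Q: sigma_finite_measure Q by fact
  interpret N: sigma_finite_measure N by fact
  interpret QN: pair_sigma_finite Q N ..
  define F where "F = (\<lambda>y. \<integral>\<^sup>+t. \<phi> t y * w t \<partial>N)"
  define M where "M = (\<integral>\<^sup>+t. w t \<partial>N)"
  have [measurable]: "F \<in> borel_measurable Q" unfolding F_def by measurable
  have section_Q [measurable]: "\<phi> t \<in> borel_measurable Q" if "t \<in> space N" for t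
    using measurable_compose[OF measurable_Pair2'[OF that] \<phi>] by simp
  have section_N [measurable]: "(\<lambda>t. \<phi> t y) \<in> borel_measurable N" if "y \<in> space Q" for y
    using measurable_compose[OF measurable_Pair1'[OF that] \<phi>] by simp
  \<comment> \<open>A positive factor keeps the bound true when the total weight is infinite.\<close>
  have a0: "0 < 1 - (h\<^sup>2 / 2 - x\<^sup>2)" using h zero_le_power2[of x] by linarith
  consider "M = 0" | "M = \<top>" | "M \<noteq> 0" "M \<noteq> \<top>" by blast
  then show ?thesis
  proof cases
    case 1
    then have w0: "AE t in N. w t = 0" by (simp add: M_def nn_integral_0_iff_AE)
    have "F y = 0" if "y \<in> space Q" for y
      unfolding F_def using w0 section_N[OF that] by (subst nn_integral_0_iff_AE) auto
    then have "(\<integral>\<^sup>+y. esqrt (p y * F y) \<partial>Q) = 0"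
      by (auto simp: nn_integral_0_iff_AE)
    then show ?thesis by (simp add: F_def)
  next
    case 2
    then show ?thesis using a0 by (simp add: M_def ennreal_mult_top)
  next
    case 3
    define s where "s = esqrt M"
    have sM: "s * s = M" "s \<noteq> 0" "s \<noteq> \<top>" using 3 by (simp_all add: s_def)
    define X Y where "X = s * (\<integral>\<^sup>+y. esqrt (p y * F y) \<partial>Q)" and "Y = s * (\<integral>\<^sup>+y. esqrt (q y * F y) \<partial>Q)"
    \<comment> \<open>The midpoint inequality, homogenised: both sides are multiplied by the total weight \<open>M = s * s\<close>.\<close>
    have pointwise: "4 * (s * esqrt (p y * F y)) + 4 * (s * esqrt (q y * F y))
        \<le> M * (p y + q y + 2 * esqrt (p y * q y)) + 4 * F y" for y
    proof -
      have "2 * (s * (esqrt (p y) + esqrt (q y))) * (2 * esqrt (F y))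
          \<le> (s * (esqrt (p y) + esqrt (q y)))\<^sup>2 + (2 * esqrt (F y))\<^sup>2"
        by (rule ennreal_sum_squares_bound)
      also have "\<dots> = s\<^sup>2 * ((esqrt (p y))\<^sup>2 + (esqrt (q y))\<^sup>2 + 2 * (esqrt (p y) * esqrt (q y))) + 4 * F y"
        by (simp only: power_mult_distrib esqrt_power2 power2_sum) (simp add: ac_simps)
      finally show ?thesis using sM(1)
        by (simp add: esqrt_mult power2_eq_square[of s] algebra_simps)
    qed
    have F1: "(\<integral>\<^sup>+y. F y \<partial>Q) \<le> M"
    proof -
      have "(\<integral>\<^sup>+y. F y \<partial>Q) = (\<integral>\<^sup>+t. \<integral>\<^sup>+y. \<phi> t y * w t \<partial>Q \<partial>N)"
        unfolding F_def by (rule QN.Fubini'[symmetric]) measurable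
      also have "\<dots> = (\<integral>\<^sup>+t. (\<integral>\<^sup>+y. \<phi> t y \<partial>Q) * w t \<partial>N)"
        by (intro nn_integral_cong nn_integral_multc) auto
      also have "\<dots> \<le> (\<integral>\<^sup>+t. w t \<partial>N)"
      proof (rule nn_integral_mono)
        fix t assume "t \<in> space N"
        then show "(\<integral>\<^sup>+y. \<phi> t y \<partial>Q) * w t \<le> w t"
          using mult_right_mono[OF \<phi>1, of t "w t"] by (cases "w t = 0") auto
      qed
      finally show ?thesis by (simp add: M_def)
    qed
    have "4 * X + 4 * Y = (\<integral>\<^sup>+y. 4 * (s * esqrt (p y * F y)) + 4 * (s * esqrt (q y * F y)) \<partial>Q)"
      unfolding X_def Y_def by (subst nn_integral_add) (auto simp: nn_integral_cmult)
    also have "\<dots> \<le> (\<integral>\<^sup>+y. M * (p y + q y + 2 * esqrt (p y * q y)) + 4 * F y \<partial>Q)"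
      by (intro nn_integral_mono pointwise)
    also have "\<dots> = M * ((\<integral>\<^sup>+y. p y \<partial>Q) + (\<integral>\<^sup>+y. q y \<partial>Q) + 2 * (\<integral>\<^sup>+y. esqrt (p y * q y) \<partial>Q)) + 4 * (\<integral>\<^sup>+y. F y \<partial>Q)"
      by (simp add: nn_integral_add nn_integral_cmult)
    also have "\<dots> \<le> M * (1 + 1 + 2 * ennreal (1 - h\<^sup>2)) + 4 * M"
      by (intro add_mono mult_left_mono p1 q1 pq F1) auto
    finally have upper: "4 * X + 4 * Y \<le> M * (1 + 1 + 2 * ennreal (1 - h\<^sup>2)) + 4 * M" .
    have lower: "M * ennreal (1 - x\<^sup>2) \<le> Y"
    proof -
      have "M * ennreal (1 - x\<^sup>2) = (\<integral>\<^sup>+t. ennreal (1 - x\<^sup>2) * w t \<partial>N)"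
        by (subst nn_integral_cmult) (auto simp: M_def mult.commute)
      also have "\<dots> \<le> (\<integral>\<^sup>+t. (\<integral>\<^sup>+y. esqrt (q y * \<phi> t y) \<partial>Q) * w t \<partial>N)"
      proof (rule nn_integral_mono)
        fix t assume "t \<in> space N"
        then show "ennreal (1 - x\<^sup>2) * w t \<le> (\<integral>\<^sup>+y. esqrt (q y * \<phi> t y) \<partial>Q) * w t"
          using mult_right_mono[OF \<phi>q, of t "w t"] by (cases "w t = 0") auto
      qed
      also have "\<dots> = (\<integral>\<^sup>+t. \<integral>\<^sup>+y. esqrt (q y * \<phi> t y) * w t \<partial>Q \<partial>N)"
        by (intro nn_integral_cong nn_integral_multc[symmetric]) auto
      also have "\<dots> = (\<integral>\<^sup>+y. \<integral>\<^sup>+t. esqrt (q y * \<phi> t y) * w t \<partial>N \<partial>Q)"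
        by (rule QN.Fubini') measurable
      also have "\<dots> \<le> (\<integral>\<^sup>+y. s * esqrt (q y * F y) \<partial>Q)"
      proof (rule nn_integral_mono)
        fix y assume y [measurable]: "y \<in> space Q"
        have "(\<integral>\<^sup>+t. esqrt (q y * \<phi> t y) * w t \<partial>N) = esqrt (q y) * (\<integral>\<^sup>+t. esqrt (\<phi> t y * w t) * esqrt (w t) \<partial>N)"
          by (subst nn_integral_cmult[symmetric]) (auto simp: esqrt_mult mult.assoc)
        also have "\<dots> \<le> esqrt (q y) * (esqrt (F y) * s)"
          unfolding F_def s_def M_def by (intro mult_left_mono nn_integral_esqrt_mult_le) auto
        finally show "(\<integral>\<^sup>+t. esqrt (q y * \<phi> t y) * w t \<partial>N) \<le> s * esqrt (q y * F y)"
          by (simp add: esqrt_mult ac_simps)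
      qed
      also have "\<dots> = Y" unfolding Y_def by (rule nn_integral_cmult) measurable
      finally show ?thesis .
    qed
    obtain m where m: "M = ennreal m" "0 \<le> m" using 3 by (cases M) auto
    have upper': "4 * X + 4 * Y \<le> ennreal (m * (4 - 2 * h\<^sup>2) + 4 * m)"
    proof -
      have "M * (1 + 1 + 2 * ennreal (1 - h\<^sup>2)) + 4 * M = ennreal (m * (1 + 1 + 2 * (1 - h\<^sup>2)) + 4 * m)"
      proof -
        have "ennreal (1 + 1 + 2 * (1 - h\<^sup>2)) = ennreal (1 + 1) + ennreal (2 * (1 - h\<^sup>2))"
          using h by (intro ennreal_plus) auto
        also have "\<dots> = 1 + 1 + 2 * ennreal (1 - h\<^sup>2)"
          by (subst ennreal_mult') auto
        finally have "1 + 1 + 2 * ennreal (1 - h\<^sup>2) = ennreal (1 + 1 + 2 * (1 - h\<^sup>2))" ..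
        then show ?thesis using m h by (simp add: ennreal_mult' ennreal_mult'')
      qed
      with upper show ?thesis by (simp add: algebra_simps)
    qed
    have "4 * X + 4 * Y < \<top>" by (rule le_less_trans[OF upper']) simp
    then have "X \<noteq> \<top>" "Y \<noteq> \<top>" by (auto simp: ennreal_mult_top)
    then obtain X' Y' where XY: "X = ennreal X'" "0 \<le> X'" "Y = ennreal Y'" "0 \<le> Y'"
      by (cases X; cases Y) auto
    have "4 * X' + 4 * Y' \<le> m * (4 - 2 * h\<^sup>2) + 4 * m"
      using upper' XY m(2) h
      by (simp add: ennreal_mult[symmetric] flip: ennreal_plus ennreal_numeral)
    moreover have "m * (1 - x\<^sup>2) \<le> Y'"
      using lower XY m x by (simp add: ennreal_mult[symmetric])
    ultimately have "X' \<le> m * (1 - (h\<^sup>2 / 2 - x\<^sup>2))" by (simp add: algebra_simps)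
    then have "X \<le> M * ennreal (1 - (h\<^sup>2 / 2 - x\<^sup>2))"
      using XY m a0 by (simp add: ennreal_mult[symmetric])
    then have "s * (\<integral>\<^sup>+y. esqrt (p y * F y) \<partial>Q) \<le> s * (s * ennreal (1 - (h\<^sup>2 / 2 - x\<^sup>2)))"
      unfolding X_def sM(1)[symmetric] by (simp add: mult.assoc)
    then have "(\<integral>\<^sup>+y. esqrt (p y * F y) \<partial>Q) \<le> s * ennreal (1 - (h\<^sup>2 / 2 - x\<^sup>2))"
      using sM by (simp add: ennreal_mult_le_mult_iff)
    then show ?thesis by (simp add: F_def s_def M_def mult.commute)
  qed
qed

text \<open>Integrating out the last observation first, the likelihood of the earlier ones acts as a new
weight on the same set \<open>B\<close>. The hypothesis for one observation is therefore required for all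
weights vanishing off \<open>B\<close>; each observation then contributes one factor \<open>a\<close>.\<close>

lemma tensorized_mixture_affinity_le:
  fixes g :: "'t \<Rightarrow> 'x \<Rightarrow> ennreal" and w :: "'t \<Rightarrow> ennreal"
  assumes R: "prob_space R" and N: "sigma_finite_measure N"
    and g [measurable]: "(\<lambda>(y, t). g t y) \<in> borel_measurable (R \<Otimes>\<^sub>M N)"
    and single: "\<And>w. w \<in> borel_measurable N \<Longrightarrow> (\<And>t. t \<in> space N \<Longrightarrow> t \<notin> B \<Longrightarrow> w t = 0) \<Longrightarrow>
        (\<integral>\<^sup>+y. esqrt (\<integral>\<^sup>+t. g t y * w t \<partial>N) \<partial>R) \<le> a * esqrt (\<integral>\<^sup>+t. w t \<partial>N)"
    and w [measurable]: "w \<in> borel_measurable N" and wB: "\<And>t. t \<in> space N \<Longrightarrow> t \<notin> B \<Longrightarrow> w t = 0"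
  shows "(\<integral>\<^sup>+x. esqrt (\<integral>\<^sup>+t. (\<Prod>i<n. g t (x i)) * w t \<partial>N) \<partial>(\<Pi>\<^sub>M i\<in>{..<n}. R))
      \<le> a ^ n * esqrt (\<integral>\<^sup>+t. w t \<partial>N)"
proof (induction n)
  interpret R: prob_space R by fact
  interpret N: sigma_finite_measure N by fact
  interpret PR: product_sigma_finite "\<lambda>_::nat. R" by (rule product_sigma_finite.intro) unfold_locales
  have G [measurable]: "(\<lambda>(x, t). \<Prod>i<n. g t (x i)) \<in> borel_measurable ((\<Pi>\<^sub>M i\<in>{..<n}. R) \<Otimes>\<^sub>M N)" for n
  proof -
    have "(\<lambda>z. g (snd z) (fst z i)) \<in> borel_measurable ((\<Pi>\<^sub>M i\<in>{..<n}. R) \<Otimes>\<^sub>M N)" if "i < n" for i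
      by (rule measurable_compose[where g="\<lambda>z. g (snd z) (fst z)" and f="\<lambda>z. (fst z i, snd z)", simplified])
         (use that g in \<open>auto simp: case_prod_unfold intro!: measurable_Pair
            measurable_compose[OF measurable_fst measurable_component_singleton]\<close>)
    then show ?thesis unfolding case_prod_unfold by (intro borel_measurable_prod_ennreal) auto
  qed
  {
    case 0
    show ?case by (simp add: PiM_empty nn_integral_count_space_finite)
  next
    case (Suc n)
    have ins: "{..<Suc n} = insert n {..<n}" by auto
    have step: "(\<integral>\<^sup>+y. esqrt (\<integral>\<^sup>+t. (\<Prod>i<Suc n. g t ((x(n := y)) i)) * w t \<partial>N) \<partial>R)
        \<le> a * esqrt (\<integral>\<^sup>+t. (\<Prod>i<n. g t (x i)) * w t \<partial>N)" if x: "x \<in> space (\<Pi>\<^sub>M i\<in>{..<n}. R)" for x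
    proof -
      have [measurable]: "(\<lambda>t. \<Prod>i<n. g t (x i)) \<in> borel_measurable N"
        using measurable_compose[OF measurable_Pair1'[OF x] G[of n]] by simp
      have "(\<Prod>i<Suc n. g t ((x(n := y)) i)) * w t = g t y * ((\<Prod>i<n. g t (x i)) * w t)" for t y
        by (simp add: ac_simps)
      then show ?thesis
        using single[of "\<lambda>t. (\<Prod>i<n. g t (x i)) * w t"] wB by (simp del: prod.lessThan_Suc)
    qed
    have "(\<integral>\<^sup>+x. esqrt (\<integral>\<^sup>+t. (\<Prod>i<Suc n. g t (x i)) * w t \<partial>N) \<partial>(\<Pi>\<^sub>M i\<in>{..<Suc n}. R))
      = (\<integral>\<^sup>+x. \<integral>\<^sup>+y. esqrt (\<integral>\<^sup>+t. (\<Prod>i<Suc n. g t ((x(n := y)) i)) * w t \<partial>N) \<partial>R \<partial>(\<Pi>\<^sub>M i\<in>{..<n}. R))"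
      unfolding ins
      by (rule PR.product_nn_integral_insert) (use G[of "Suc n"] in \<open>auto simp flip: ins\<close>)
    also have "\<dots> \<le> (\<integral>\<^sup>+x. a * esqrt (\<integral>\<^sup>+t. (\<Prod>i<n. g t (x i)) * w t \<partial>N) \<partial>(\<Pi>\<^sub>M i\<in>{..<n}. R))"
      by (intro nn_integral_mono step)
    also have "\<dots> = a * (\<integral>\<^sup>+x. esqrt (\<integral>\<^sup>+t. (\<Prod>i<n. g t (x i)) * w t \<partial>N) \<partial>(\<Pi>\<^sub>M i\<in>{..<n}. R))"
      by (rule nn_integral_cmult) measurable
    also have "\<dots> \<le> a * (a ^ n * esqrt (\<integral>\<^sup>+t. w t \<partial>N))"
      by (intro mult_left_mono Suc.IH) auto
    finally show ?case by (simp add: mult.assoc)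
  }
qed

section \<open>The model as a metric space\<close>

lemma space_metric_borel [simp]: "space (metric_borel S d) = S"
  by (simp add: metric_borel_def space_measure_of_conv)

locale statistical_model =
  fixes \<mu> :: "'x measure" and S :: "'t set" and f :: "'t \<Rightarrow> 'x \<Rightarrow> real"
  assumes density_nonneg: "\<And>t x. t \<in> S \<Longrightarrow> x \<in> space \<mu> \<Longrightarrow> 0 \<le> f t x"
    and density_measurable:
      "(\<lambda>(x, t). f t x) \<in> borel_measurable (\<mu> \<Otimes>\<^sub>M metric_borel S (hdist \<mu> f))"
    and model_prob: "\<And>t. t \<in> S \<Longrightarrow> prob_space (model \<mu> f t)"
    and model_inj: "inj_on (model \<mu> f) S"
begin

lemma measurable_density: "t \<in> S \<Longrightarrow> f t \<in> borel_measurable \<mu>"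
  using measurable_compose[OF measurable_Pair2'[of t "metric_borel S (hdist \<mu> f)"] density_measurable]
  by simp

lemma sets_model [simp, measurable_cong]: "sets (model \<mu> f t) = sets \<mu>"
  and space_model [simp]: "space (model \<mu> f t) = space \<mu>"
  by (simp_all add: model_def)

lemma hellinger_affinity_model:
  assumes "t \<in> S" "u \<in> S"
  shows "(\<integral>\<^sup>+y. esqrt (ennreal (f t y) * ennreal (f u y)) \<partial>\<mu>) = ennreal (1 - (hdist \<mu> f t u)\<^sup>2)"
    and "hdist \<mu> f t u \<le> 1"
  unfolding hdist_def model_def
  by (rule hellinger_affinity;
      use assms measurable_density density_nonneg model_prob in \<open>simp add: model_def\<close>)+

lemma nn_integral_density_model: "t \<in> S \<Longrightarrow> (\<integral>\<^sup>+y. ennreal (f t y) \<partial>\<mu>) = 1"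
  and integrable_density_model: "t \<in> S \<Longrightarrow> integrable \<mu> (f t)"
  using integrable_prob_density[OF measurable_density density_nonneg, of t] model_prob[of t]
  by (auto simp: model_def)

lemma hdist_eq:
  assumes "t \<in> S" "u \<in> S"
  shows "hdist \<mu> f t u = sqrt (1 / 2 * (\<integral>y. (sqrt (f t y) - sqrt (f u y))\<^sup>2 \<partial>\<mu>))"
  unfolding hdist_def model_def
  by (rule hellinger_density)
     (use assms measurable_density density_nonneg model_prob in
       \<open>auto simp: model_def prob_space.finite_measure\<close>)

lemma hdist_integrable:
  "t \<in> S \<Longrightarrow> u \<in> S \<Longrightarrow> integrable \<mu> (\<lambda>y. (sqrt (f t y) - sqrt (f u y))\<^sup>2)"
  by (intro integrable_sqrt_diff_square integrable_density_model density_nonneg)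

lemma hdist_eq_0_iff:
  assumes t: "t \<in> S" and u: "u \<in> S"
  shows "hdist \<mu> f t u = 0 \<longleftrightarrow> t = u"
proof
  assume "hdist \<mu> f t u = 0"
  then have "AE y in \<mu>. (sqrt (f t y) - sqrt (f u y))\<^sup>2 = 0"
    using t u by (simp add: hdist_eq integral_nonneg_eq_0_iff_AE[OF hdist_integrable])
  then have "AE y in \<mu>. ennreal (f t y) = ennreal (f u y)" by (auto elim!: eventually_mono)
  then have "model \<mu> f t = model \<mu> f u"
    unfolding model_def using measurable_density[OF t] measurable_density[OF u]
    by (intro density_cong) auto
  then show "t = u" using model_inj t u by (auto dest: inj_onD)
qed (use u in \<open>simp add: hdist_eq\<close>)

text \<open>Minkowski's inequality for the square roots of the densities, obtained from the weighted inequality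
\<open>(a - c)\<^sup>2 \<le> (1 + l) * (a - b)\<^sup>2 + (1 + 1 / l) * (b - c)\<^sup>2\<close> for the optimal weight \<open>l\<close>.\<close>

lemma hdist_triangle:
  assumes t: "t \<in> S" and u: "u \<in> S" and v: "v \<in> S"
  shows "hdist \<mu> f t v \<le> hdist \<mu> f t u + hdist \<mu> f u v"
proof (cases "t = u \<or> u = v")
  case True
  then show ?thesis using hdist_eq_0_iff[OF t t] hdist_eq_0_iff[OF v v] by auto
next
  case False
  define I where "I = (\<lambda>t u. \<integral>y. (sqrt (f t y) - sqrt (f u y))\<^sup>2 \<partial>\<mu>)"
  have hI: "hdist \<mu> f t u = sqrt (1 / 2 * I t u)" if "t \<in> S" "u \<in> S" for t u
    using that by (simp add: hdist_eq I_def)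
  define A B C where "A = hdist \<mu> f t u" and "B = hdist \<mu> f u v" and "C = hdist \<mu> f t v"
  have "0 \<le> I t u" for t u by (simp add: I_def)
  then have sq: "I t u = 2 * A\<^sup>2" "I u v = 2 * B\<^sup>2" "I t v = 2 * C\<^sup>2" and nn: "0 \<le> A" "0 \<le> B"
    using t u v by (simp_all add: A_def B_def C_def hI)
  have "A \<noteq> 0" "B \<noteq> 0" using False t u v by (auto simp: A_def B_def hdist_eq_0_iff)
  with nn have pos: "0 < A" "0 < B" by auto
  define l where "l = B / A"
  have l: "0 < l" using pos by (simp add: l_def)
  have weighted: "(a - c)\<^sup>2 \<le> (1 + l) * (a - b)\<^sup>2 + (1 + 1 / l) * (b - c)\<^sup>2" for a b c :: real
  proof -
    have "0 \<le> (l * (a - b) - (b - c))\<^sup>2 / l" using l by simp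
    also have "\<dots> = (1 + l) * (a - b)\<^sup>2 + (1 + 1 / l) * (b - c)\<^sup>2 - (a - c)\<^sup>2"
      using l by (simp add: field_simps power2_eq_square)
    finally show ?thesis by simp
  qed
  have "I t v \<le> (\<integral>y. (1 + l) * (sqrt (f t y) - sqrt (f u y))\<^sup>2 + (1 + 1 / l) * (sqrt (f u y) - sqrt (f v y))\<^sup>2 \<partial>\<mu>)"
    unfolding I_def using t u v
    by (intro integral_mono hdist_integrable weighted Bochner_Integration.integrable_add
        integrable_mult_right) auto
  also have "\<dots> = (1 + l) * I t u + (1 + 1 / l) * I u v"
    unfolding I_def using t u v
    by (subst Bochner_Integration.integral_add)
       (auto intro!: integrable_mult_right hdist_integrable)
  finally have "C\<^sup>2 \<le> (1 + l) * A\<^sup>2 + (1 + 1 / l) * B\<^sup>2" by (simp add: sq algebra_simps)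
  also have "\<dots> = (A + B)\<^sup>2" using pos by (simp add: l_def field_simps power2_eq_square)
  finally have "C \<le> A + B" using nn by (intro power2_le_imp_le[of C]) auto
  then show ?thesis by (simp add: A_def B_def C_def)
qed

sublocale Metric_space S "hdist \<mu> f"
proof
  show "0 \<le> hdist \<mu> f t u" for t u by (simp add: hdist_def hellinger_def hellinger_wrt_def)
  show "hdist \<mu> f t u = hdist \<mu> f u t" for t u
    by (simp add: hdist_def hellinger_def hellinger_wrt_def sum_measure_def add.commute
        power2_commute[of "sqrt (enn2real (RN_deriv _ (model \<mu> f t) _))"])
qed (use hdist_eq_0_iff hdist_triangle in auto)

lemma mcball_in_metric_borel: "mcball t r \<in> sets (metric_borel S (hdist \<mu> f))"
proof -
  let ?T = "metric_borel S (hdist \<mu> f)"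
  have "openin mtopology (S - mcball t r)"
    using closedin_mcball[of t r] by (simp add: closedin_def)
  then have "S - mcball t r \<in> sets ?T"
    unfolding metric_borel_def using openin_subset[of mtopology] by (intro in_measure_of) auto
  from sets.compl_sets[OF this] show ?thesis
    using mcball_subset_mspace[of t r] by (simp add: double_diff)
qed

text \<open>Where \<open>f s\<close> vanishes the ratio is zero by the convention for division; this happens only on a null set
of \<open>P\<^sub>s\<close>, the distribution under which the ratio is integrated.\<close>

definition likelihood_ratio :: "'t \<Rightarrow> 't \<Rightarrow> 'x \<Rightarrow> ennreal" where
  "likelihood_ratio s t y = ennreal (f t y / f s y)"

lemma nn_integral_model:
  assumes s: "s \<in> S" and [measurable]: "g \<in> borel_measurable \<mu>"
  shows "(\<integral>\<^sup>+y. g y \<partial>model \<mu> f s) = (\<integral>\<^sup>+y. ennreal (f s y) * g y \<partial>\<mu>)"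
  unfolding model_def using measurable_density[OF s] by (subst nn_integral_density) auto

lemma measurable_likelihood_ratio:
  "s \<in> S \<Longrightarrow> t \<in> S \<Longrightarrow> likelihood_ratio s t \<in> borel_measurable \<mu>"
  unfolding likelihood_ratio_def[abs_def] using measurable_density[measurable] by measurable

text \<open>The integral is the mass that \<open>P\<^sub>t\<close> puts on the set where \<open>f s\<close> is positive.\<close>

lemma likelihood_ratio_integral_le_1:
  assumes s: "s \<in> S" and t: "t \<in> S"
  shows "(\<integral>\<^sup>+y. likelihood_ratio s t y \<partial>model \<mu> f s) \<le> 1"
proof -
  have "(\<integral>\<^sup>+y. likelihood_ratio s t y \<partial>model \<mu> f s) \<le> (\<integral>\<^sup>+y. ennreal (f t y) \<partial>\<mu>)"
    unfolding nn_integral_model[OF s measurable_likelihood_ratio[OF s t]]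
    using density_nonneg s t
    by (intro nn_integral_mono) (auto simp: likelihood_ratio_def ennreal_mult[symmetric])
  then show ?thesis using t by (simp add: nn_integral_density_model)
qed

lemma likelihood_ratio_affinity:
  assumes s: "s \<in> S" and t: "t \<in> S"
  shows "(\<integral>\<^sup>+y. esqrt (likelihood_ratio s t y) \<partial>model \<mu> f s) = ennreal (1 - (hdist \<mu> f s t)\<^sup>2)"
proof -
  have [measurable]: "likelihood_ratio s t \<in> borel_measurable \<mu>"
    by (rule measurable_likelihood_ratio[OF s t])
  have "(\<integral>\<^sup>+y. esqrt (likelihood_ratio s t y) \<partial>model \<mu> f s)
      = (\<integral>\<^sup>+y. esqrt (ennreal (f s y) * ennreal (f t y)) \<partial>\<mu>)"
    unfolding nn_integral_model[OF s, of "\<lambda>y. esqrt (likelihood_ratio s t y)", simplified]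
  proof (rule nn_integral_cong)
    fix y assume "y \<in> space \<mu>"
    then have nn: "0 \<le> f s y" "0 \<le> f t y" using s t density_nonneg by auto
    show "ennreal (f s y) * esqrt (likelihood_ratio s t y) = esqrt (ennreal (f s y) * ennreal (f t y))"
    proof (cases "f s y = 0")
      case False
      then have "f s y * sqrt (f t y / f s y) = sqrt (f s y * f t y)"
        using nn real_sqrt_mult_self[of "f s y"]
        by (auto simp: real_sqrt_divide real_sqrt_mult field_simps)
      then show ?thesis using nn by (simp add: likelihood_ratio_def ennreal_mult[symmetric])
    qed simp
  qed
  then show ?thesis using hellinger_affinity_model[OF s t] by simp
qed

end

section \<open>Likelihood ratios averaged over a prior\<close>

locale bayes_model = statistical_model \<mu> S f
  for \<mu> :: "'x measure" and S :: "'t set" and f :: "'t \<Rightarrow> 'x \<Rightarrow> real" +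
  fixes \<nu> :: "'t measure" and s :: 't
  assumes prior: "prob_space \<nu>" "sets \<nu> = sets (metric_borel S (hdist \<mu> f))"
    and s: "s \<in> S"
begin

sublocale prior: prob_space \<nu> by (rule prior(1))

sublocale centre: prob_space "model \<mu> f s" by (rule model_prob[OF s])

lemma space_prior [simp]: "space \<nu> = S"
  using sets_eq_imp_space_eq[OF prior(2)] by simp

lemma carrier_in_prior [measurable]: "S \<in> sets \<nu>"
  using sets.top[of \<nu>] by simp

lemma mcball_in_prior [measurable]: "mcball t r \<in> sets \<nu>"
  using mcball_in_metric_borel prior(2) by simp

lemma measurable_density_prior [measurable]: "(\<lambda>(y, t). f t y) \<in> borel_measurable (\<mu> \<Otimes>\<^sub>M \<nu>)"
  using density_measurable prior(2) by (simp cong: measurable_cong_sets sets_pair_measure_cong)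

lemma measurable_density_s [measurable]: "f s \<in> borel_measurable \<mu>"
  by (rule measurable_density[OF s])

lemma measurable_likelihood_ratio_pair [measurable]:
  "(\<lambda>(y, t). likelihood_ratio s t y) \<in> borel_measurable (\<mu> \<Otimes>\<^sub>M \<nu>)"
  unfolding likelihood_ratio_def by measurable

text \<open>The reference measure \<open>\<mu>\<close> is arbitrary, while the interchange of integrals in
\<open>mixture_affinity_le\<close> needs a \<open>\<sigma>\<close>-finite one. Only the part of the sample space charged by \<open>P\<^sub>s\<close> or
by \<open>P\<^sub>u\<close> matters, so the densities are taken with respect to the finite measure \<open>Q = P\<^sub>s + P\<^sub>u\<close>.\<close>

lemma ball_mixture_affinity_le:
  assumes u: "u \<in> S" and r: "r \<le> hdist \<mu> f s u" "0 \<le> r" and x: "0 \<le> x" "x \<le> 1"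
    and w [measurable]: "w \<in> borel_measurable \<nu>"
    and wB: "\<And>t. t \<in> space \<nu> \<Longrightarrow> t \<notin> mcball u x \<Longrightarrow> w t = 0"
  shows "(\<integral>\<^sup>+y. esqrt (\<integral>\<^sup>+t. likelihood_ratio s t y * w t \<partial>\<nu>) \<partial>model \<mu> f s)
      \<le> ennreal (1 - (r\<^sup>2 / 2 - x\<^sup>2)) * esqrt (\<integral>\<^sup>+t. w t \<partial>\<nu>)"
proof -
  have [measurable]: "f u \<in> borel_measurable \<mu>" by (rule measurable_density[OF u])
  have ft [measurable]: "f t \<in> borel_measurable \<mu>" if "t \<in> S" for t by (rule measurable_density[OF that])
  define H where "H = (\<lambda>y. f s y + f u y)"
  have [measurable]: "H \<in> borel_measurable \<mu>" unfolding H_def by measurable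
  have nn: "0 \<le> f s y" "0 \<le> f u y" "0 \<le> H y" if "y \<in> space \<mu>" for y
    using that s u density_nonneg by (auto simp: H_def)
  have Hz: "f s y = 0" "f u y = 0" if "y \<in> space \<mu>" "H y = 0" for y
    using nn[OF that(1)] that(2) by (auto simp: H_def)
  define Q where "Q = density \<mu> (\<lambda>y. ennreal (H y))"
  have Qint: "(\<integral>\<^sup>+y. g y \<partial>Q) = (\<integral>\<^sup>+y. ennreal (H y) * g y \<partial>\<mu>)" if "g \<in> borel_measurable \<mu>" for g
    unfolding Q_def using that by (subst nn_integral_density) auto
  have [measurable_cong]: "sets Q = sets \<mu>" and [simp]: "space Q = space \<mu>" by (simp_all add: Q_def)
  have "(\<integral>\<^sup>+y. ennreal (H y) \<partial>\<mu>) = (\<integral>\<^sup>+y. ennreal (f s y) \<partial>\<mu>) + (\<integral>\<^sup>+y. ennreal (f u y) \<partial>\<mu>)"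
    unfolding H_def using nn by (subst nn_integral_add[symmetric]) (auto intro!: nn_integral_cong)
  then have "emeasure Q (space Q) = 2"
    using s u by (simp add: Q_def emeasure_density nn_integral_density_model cong: nn_integral_cong)
  then interpret Q: finite_measure Q by (intro finite_measureI) simp
  define \<phi> where "\<phi> = (\<lambda>t y. ennreal (f t y / H y))"
  have [measurable]: "(\<lambda>(y, t). \<phi> t y) \<in> borel_measurable (\<mu> \<Otimes>\<^sub>M \<nu>)"
    unfolding \<phi>_def by measurable
  have [measurable]: "\<phi> t \<in> borel_measurable \<mu>" if "t \<in> S" for t
    unfolding \<phi>_def using that by measurable
  have \<phi>_le: "ennreal (H y) * \<phi> t y \<le> ennreal (f t y)" if "y \<in> space \<mu>" "t \<in> S" for y t
    using nn[OF that(1)] density_nonneg[OF that(2,1)] by (auto simp: \<phi>_def ennreal_mult[symmetric])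
  have \<phi>_int: "(\<integral>\<^sup>+y. \<phi> t y \<partial>Q) \<le> 1" if "t \<in> S" for t
  proof -
    have "(\<integral>\<^sup>+y. ennreal (H y) * \<phi> t y \<partial>\<mu>) \<le> (\<integral>\<^sup>+y. ennreal (f t y) \<partial>\<mu>)"
      by (intro nn_integral_mono \<phi>_le that)
    then show ?thesis using that by (simp add: Qint nn_integral_density_model)
  qed
  \<comment> \<open>The product \<open>f t y * f v y\<close> vanishes wherever \<open>H y = 0\<close>, so no affinity is lost by passing to \<open>Q\<close>.\<close>
  have \<phi>_aff: "(\<integral>\<^sup>+y. esqrt (\<phi> t y * \<phi> v y) \<partial>Q) = ennreal (1 - (hdist \<mu> f t v)\<^sup>2)"
    if t: "t \<in> {s, u}" and v: "v \<in> S" for t v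
  proof -
    have t': "t \<in> S" using t s u by auto
    have "(\<integral>\<^sup>+y. esqrt (\<phi> t y * \<phi> v y) \<partial>Q) = (\<integral>\<^sup>+y. ennreal (H y) * esqrt (\<phi> t y * \<phi> v y) \<partial>\<mu>)"
      by (rule Qint) (use t' v in measurable)
    also have "\<dots> = (\<integral>\<^sup>+y. esqrt (ennreal (f t y) * ennreal (f v y)) \<partial>\<mu>)"
    proof (rule nn_integral_cong)
      fix y assume y: "y \<in> space \<mu>"
      have nn': "0 \<le> f t y" "0 \<le> f v y" "0 \<le> H y" using y t' v density_nonneg nn by auto
      have "H y * sqrt (f t y / H y * (f v y / H y)) = sqrt (f t y * f v y)"
        using nn' Hz[OF y] t by (cases "H y = 0") (auto simp: real_sqrt_divide)
      then show "ennreal (H y) * esqrt (\<phi> t y * \<phi> v y) = esqrt (ennreal (f t y) * ennreal (f v y))"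
        using nn' by (simp add: \<phi>_def ennreal_mult[symmetric])
    qed
    finally show ?thesis using hellinger_affinity_model[OF t' v] by simp
  qed
  have "(\<integral>\<^sup>+y. esqrt (\<integral>\<^sup>+t. likelihood_ratio s t y * w t \<partial>\<nu>) \<partial>model \<mu> f s)
      = (\<integral>\<^sup>+y. ennreal (f s y) * esqrt (\<integral>\<^sup>+t. likelihood_ratio s t y * w t \<partial>\<nu>) \<partial>\<mu>)"
    by (rule nn_integral_model[OF s]) measurable
  also have "\<dots> = (\<integral>\<^sup>+y. ennreal (H y) * esqrt (\<phi> s y * (\<integral>\<^sup>+t. \<phi> t y * w t \<partial>\<nu>)) \<partial>\<mu>)"
  proof (rule nn_integral_cong)
    fix y assume y: "y \<in> space \<mu>"
    have sec [measurable]: "(\<lambda>t. f t y) \<in> borel_measurable \<nu>"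
      using measurable_compose[OF measurable_Pair1'[OF y] measurable_density_prior] by simp
    show "ennreal (f s y) * esqrt (\<integral>\<^sup>+t. likelihood_ratio s t y * w t \<partial>\<nu>)
        = ennreal (H y) * esqrt (\<phi> s y * (\<integral>\<^sup>+t. \<phi> t y * w t \<partial>\<nu>))"
    proof (cases "f s y = 0")
      case True
      then show ?thesis by (simp add: \<phi>_def)
    next
      case False
      then have pos: "0 < f s y" "0 < H y" using nn[OF y] by (auto simp: H_def)
      define F where "F = (\<integral>\<^sup>+t. ennreal (f t y) * w t \<partial>\<nu>)"
      have scale: "(\<integral>\<^sup>+t. ennreal (f t y / k) * w t \<partial>\<nu>) = ennreal (1 / k) * F" if "0 < k" for k
        unfolding F_def using that density_nonneg y
        by (subst nn_integral_cmult[symmetric])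
           (auto intro!: nn_integral_cong simp: ennreal_mult[symmetric] mult.assoc[symmetric])
      have "ennreal (f s y) * esqrt (ennreal (1 / f s y) * F) = esqrt (ennreal (f s y)) * esqrt F"
      proof -
        have "f s y * sqrt (1 / f s y) = sqrt (f s y)"
          using pos by (simp add: real_sqrt_divide real_div_sqrt)
        then show ?thesis using pos
          by (simp add: esqrt_mult mult.assoc[symmetric] ennreal_mult[symmetric])
      qed
      moreover have "ennreal (H y) * esqrt (ennreal (f s y / H y) * (ennreal (1 / H y) * F))
          = esqrt (ennreal (f s y)) * esqrt F"
      proof -
        have "H y * sqrt (f s y / (H y * H y)) = sqrt (f s y)"
          using pos by (simp add: real_sqrt_divide)
        then show ?thesis using pos
          by (simp add: esqrt_mult mult.assoc[symmetric] ennreal_mult[symmetric])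
      qed
      ultimately show ?thesis
        unfolding likelihood_ratio_def \<phi>_def scale[OF pos(1)] scale[OF pos(2)] by simp
    qed
  qed
  also have "\<dots> = (\<integral>\<^sup>+y. esqrt (\<phi> s y * (\<integral>\<^sup>+t. \<phi> t y * w t \<partial>\<nu>)) \<partial>Q)"
    by (rule Qint[symmetric]) (use s in measurable)
  also have "\<dots> \<le> ennreal (1 - (r\<^sup>2 / 2 - x\<^sup>2)) * esqrt (\<integral>\<^sup>+t. w t \<partial>\<nu>)"
  proof (rule mixture_affinity_le[where q="\<phi> u"])
    have r1: "r \<le> 1" using r hellinger_affinity_model(2)[OF s u] by simp
    then show "r\<^sup>2 \<le> 1" "x\<^sup>2 \<le> 1" using r x by (auto simp: power_le_one)
    show "(\<integral>\<^sup>+y. esqrt (\<phi> s y * \<phi> u y) \<partial>Q) \<le> ennreal (1 - r\<^sup>2)"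
      using \<phi>_aff[of s u] u r by (auto intro!: ennreal_leI power_mono)
    fix t assume t: "t \<in> space \<nu>" "w t \<noteq> 0"
    then show "(\<integral>\<^sup>+y. \<phi> t y \<partial>Q) \<le> 1" using \<phi>_int by simp
    have "t \<in> mcball u x" using wB t by blast
    then have "hdist \<mu> f u t \<le> x" "t \<in> S" by auto
    then show "ennreal (1 - x\<^sup>2) \<le> (\<integral>\<^sup>+y. esqrt (\<phi> u y * \<phi> t y) \<partial>Q)"
      using \<phi>_aff[of u t] x by (auto intro!: ennreal_leI power_mono)
  qed (use s u \<phi>_int Q.sigma_finite_measure_axioms prior.sigma_finite_measure_axioms in auto)
  finally show ?thesis .
qed

end

section \<open>Samples of size \<open>n\<close>\<close>

text \<open>A separated subset of maximal cardinality is a net, as any point far from it could be added.\<close>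

lemma separated_cover:
  fixes d :: "'t \<Rightarrow> 't \<Rightarrow> real" and K x :: real
  assumes bound: "\<And>N. N \<subseteq> A \<Longrightarrow> separated d x N \<Longrightarrow> finite N \<and> real (card N) \<le> K"
    and sym: "\<And>t u. d t u = d u t" and refl: "\<And>t. t \<in> A \<Longrightarrow> d t t \<le> x"
  obtains N where "N \<subseteq> A" "finite N" "real (card N) \<le> K" "\<And>t. t \<in> A \<Longrightarrow> \<exists>u\<in>N. d u t \<le> x"
proof -
  let ?Q = "\<lambda>N. N \<subseteq> A \<and> separated d x N"
  have "?Q {}" by (simp add: separated_def)
  moreover have "\<forall>N. ?Q N \<longrightarrow> card N < Suc (nat \<lfloor>K\<rfloor>)"
    using bound by (auto simp: less_Suc_eq_le le_nat_floor)
  ultimately have "\<exists>N. ?Q N \<and> (\<forall>N'. ?Q N' \<longrightarrow> card N' \<le> card N)"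
    by (rule ex_has_greatest_nat)
  then obtain N where N: "?Q N" and max: "\<And>N'. ?Q N' \<Longrightarrow> card N' \<le> card N"
    by auto
  have fin: "finite N" "real (card N) \<le> K" using bound N by auto
  have "\<exists>u\<in>N. d u t \<le> x" if t: "t \<in> A" for t
  proof (rule ccontr)
    assume far: "\<not> (\<exists>u\<in>N. d u t \<le> x)"
    then have "t \<notin> N" using refl[OF t] by blast
    moreover have "?Q (insert t N)"
      using N t far sym by (auto simp: separated_def not_le)
    then have "card (insert t N) \<le> card N" using max by blast
    ultimately show False using fin by simp
  qed
  with that N fin show thesis by blast
qed

context bayes_model
begin

definition sample_law :: "nat \<Rightarrow> (nat \<Rightarrow> 'x) measure" where
  "sample_law n = (\<Pi>\<^sub>M i\<in>{..<n}. model \<mu> f s)"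

definition sample_ratio :: "nat \<Rightarrow> (nat \<Rightarrow> 'x) \<Rightarrow> 't \<Rightarrow> ennreal" where
  "sample_ratio n x t = (\<Prod>i<n. likelihood_ratio s t (x i))"

text \<open>The marginal likelihood of the parameters in \<open>A\<close>, divided by the likelihood at \<open>s\<close>.\<close>

definition evidence :: "nat \<Rightarrow> 't set \<Rightarrow> (nat \<Rightarrow> 'x) \<Rightarrow> ennreal" where
  "evidence n A x = (\<integral>\<^sup>+t. sample_ratio n x t * indicator A t \<partial>\<nu>)"

lemma prob_space_sample_law: "prob_space (sample_law n)"
  unfolding sample_law_def by (rule prob_space_PiM) unfold_locales

lemma measurable_sample_component:
  "i < n \<Longrightarrow> (\<lambda>z. (fst z i, snd z)) \<in> sample_law n \<Otimes>\<^sub>M \<nu> \<rightarrow>\<^sub>M \<mu> \<Otimes>\<^sub>M \<nu>"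
  unfolding sample_law_def
  by (intro measurable_Pair measurable_compose[OF measurable_fst] measurable_snd)
     (auto intro: measurable_component_singleton[of i "{..<n}" "\<lambda>_. model \<mu> f s", simplified])

lemma measurable_sample_ratio [measurable]:
  "(\<lambda>(x, t). sample_ratio n x t) \<in> borel_measurable (sample_law n \<Otimes>\<^sub>M \<nu>)"
proof -
  have "(\<lambda>z. likelihood_ratio s (snd z) (fst z i)) \<in> borel_measurable (sample_law n \<Otimes>\<^sub>M \<nu>)" if "i < n" for i
    using measurable_compose[OF measurable_sample_component[OF that] measurable_likelihood_ratio_pair] by simp
  then show ?thesis
    unfolding sample_ratio_def case_prod_unfold by (intro borel_measurable_prod_ennreal) auto
qed

lemma measurable_sample_ratio_fst: "t \<in> S \<Longrightarrow> (\<lambda>x. sample_ratio n x t) \<in> borel_measurable (sample_law n)"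
  using measurable_compose[OF measurable_Pair2' measurable_sample_ratio, of t n] by simp

lemma measurable_sample_ratio_snd:
  "x \<in> space (sample_law n) \<Longrightarrow> sample_ratio n x \<in> borel_measurable \<nu>"
  using measurable_compose[OF measurable_Pair1' measurable_sample_ratio, of x n] by simp

lemma measurable_evidence [measurable]:
  assumes [measurable]: "A \<in> sets \<nu>"
  shows "evidence n A \<in> borel_measurable (sample_law n)"
  unfolding evidence_def[abs_def] by measurable

lemma sample_ratio_integral:
  assumes t: "t \<in> S"
  shows "(\<integral>\<^sup>+x. sample_ratio n x t \<partial>sample_law n) \<le> 1"
    and "(\<integral>\<^sup>+x. esqrt (sample_ratio n x t) \<partial>sample_law n) = ennreal ((1 - (hdist \<mu> f s t)\<^sup>2) ^ n)"
proof -
  interpret P: product_sigma_finite "\<lambda>_::nat. model \<mu> f s"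
    by (rule product_sigma_finite.intro) unfold_locales
  have [measurable]: "likelihood_ratio s t \<in> borel_measurable \<mu>"
    by (rule measurable_likelihood_ratio[OF s t])
  have "(\<integral>\<^sup>+x. sample_ratio n x t \<partial>sample_law n) = (\<Prod>i<n. \<integral>\<^sup>+y. likelihood_ratio s t y \<partial>model \<mu> f s)"
    unfolding sample_ratio_def sample_law_def by (rule P.product_nn_integral_prod) auto
  also have "\<dots> \<le> (\<Prod>i<n. 1)"
    using likelihood_ratio_integral_le_1[OF s t] by (intro prod_mono_ennreal) auto
  finally show "(\<integral>\<^sup>+x. sample_ratio n x t \<partial>sample_law n) \<le> 1" by simp
  have "(\<integral>\<^sup>+x. esqrt (sample_ratio n x t) \<partial>sample_law n) = (\<Prod>i<n. \<integral>\<^sup>+y. esqrt (likelihood_ratio s t y) \<partial>model \<mu> f s)"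
    unfolding sample_ratio_def sample_law_def esqrt_prod by (rule P.product_nn_integral_prod) auto
  also have "\<dots> = ennreal ((1 - (hdist \<mu> f s t)\<^sup>2) ^ n)"
    using hellinger_affinity_model(2)[OF s t]
    by (simp add: likelihood_ratio_affinity[OF s t] ennreal_power power_le_one)
  finally show "(\<integral>\<^sup>+x. esqrt (sample_ratio n x t) \<partial>sample_law n) = ennreal ((1 - (hdist \<mu> f s t)\<^sup>2) ^ n)" .
qed

lemma pair_sigma_finite_sample: "pair_sigma_finite (sample_law n) \<nu>"
  using prob_space_sample_law prior(1)
  by (intro pair_sigma_finite.intro prob_space_imp_sigma_finite)

lemma evidence_integral_le:
  assumes [measurable]: "A \<in> sets \<nu>"
  shows "(\<integral>\<^sup>+x. evidence n A x \<partial>sample_law n) \<le> emeasure \<nu> A"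
proof -
  have "(\<integral>\<^sup>+x. evidence n A x \<partial>sample_law n)
      = (\<integral>\<^sup>+t. \<integral>\<^sup>+x. sample_ratio n x t * indicator A t \<partial>sample_law n \<partial>\<nu>)"
    unfolding evidence_def
    by (rule pair_sigma_finite.Fubini'[OF pair_sigma_finite_sample, symmetric]) measurable
  also have "\<dots> = (\<integral>\<^sup>+t. (\<integral>\<^sup>+x. sample_ratio n x t \<partial>sample_law n) * indicator A t \<partial>\<nu>)"
    by (intro nn_integral_cong nn_integral_multc) (simp add: measurable_sample_ratio_fst)
  also have "\<dots> \<le> (\<integral>\<^sup>+t. indicator A t \<partial>\<nu>)"
    using sample_ratio_integral(1) by (intro nn_integral_mono) (auto simp: indicator_def)
  finally show ?thesis by simp
qed

text \<open>Concavity of the square root bounds the affinity with the mixture over \<open>A\<close> from below by the average of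
the affinities with its components, each of which is at least \<open>(1 - \<epsilon>\<^sup>2) ^ n\<close>.\<close>

lemma evidence_sqrt_integral_ge:
  assumes A [measurable]: "A \<in> sets \<nu>" and near: "A \<subseteq> mcball s \<epsilon>" and \<epsilon>: "0 \<le> \<epsilon>" "\<epsilon> \<le> 1"
  shows "ennreal ((1 - \<epsilon>\<^sup>2) ^ n) * emeasure \<nu> A
      \<le> (\<integral>\<^sup>+x. esqrt (evidence n A x) * esqrt (emeasure \<nu> A) \<partial>sample_law n)"
proof -
  have "ennreal ((1 - \<epsilon>\<^sup>2) ^ n) * emeasure \<nu> A = (\<integral>\<^sup>+t. ennreal ((1 - \<epsilon>\<^sup>2) ^ n) * indicator A t \<partial>\<nu>)"
    by (simp add: nn_integral_cmult)
  also have "\<dots> \<le> (\<integral>\<^sup>+t. (\<integral>\<^sup>+x. esqrt (sample_ratio n x t) \<partial>sample_law n) * indicator A t \<partial>\<nu>)"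
  proof (rule nn_integral_mono)
    fix t assume t: "t \<in> space \<nu>"
    have "ennreal ((1 - \<epsilon>\<^sup>2) ^ n) \<le> (\<integral>\<^sup>+x. esqrt (sample_ratio n x t) \<partial>sample_law n)" if "t \<in> A"
    proof -
      have "hdist \<mu> f s t \<le> \<epsilon>" using near that by auto
      then show ?thesis using t \<epsilon>
        by (simp add: sample_ratio_integral power_mono power_le_one ennreal_leI)
    qed
    then show "ennreal ((1 - \<epsilon>\<^sup>2) ^ n) * indicator A t
        \<le> (\<integral>\<^sup>+x. esqrt (sample_ratio n x t) \<partial>sample_law n) * indicator A t"
      by (auto simp: indicator_def)
  qed
  also have "\<dots> = (\<integral>\<^sup>+t. \<integral>\<^sup>+x. esqrt (sample_ratio n x t) * indicator A t \<partial>sample_law n \<partial>\<nu>)"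
    by (intro nn_integral_cong nn_integral_multc[symmetric])
       (use measurable_sample_ratio_fst in simp)
  also have "\<dots> = (\<integral>\<^sup>+x. \<integral>\<^sup>+t. esqrt (sample_ratio n x t) * indicator A t \<partial>\<nu> \<partial>sample_law n)"
    by (rule pair_sigma_finite.Fubini'[OF pair_sigma_finite_sample]) measurable
  also have "\<dots> \<le> (\<integral>\<^sup>+x. esqrt (evidence n A x) * esqrt (emeasure \<nu> A) \<partial>sample_law n)"
  proof (rule nn_integral_mono)
    fix x assume "x \<in> space (sample_law n)"
    note [measurable] = measurable_sample_ratio_snd[OF this]
    have "(\<integral>\<^sup>+t. esqrt (sample_ratio n x t) * indicator A t \<partial>\<nu>)
        = (\<integral>\<^sup>+t. esqrt (sample_ratio n x t * indicator A t) * esqrt (indicator A t) \<partial>\<nu>)"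
      by (intro nn_integral_cong) (auto simp: indicator_def)
    also have "\<dots> \<le> esqrt (evidence n A x) * esqrt (\<integral>\<^sup>+t. indicator A t \<partial>\<nu>)"
      unfolding evidence_def by (rule nn_integral_esqrt_mult_le) measurable
    finally show "(\<integral>\<^sup>+t. esqrt (sample_ratio n x t) * indicator A t \<partial>\<nu>)
        \<le> esqrt (evidence n A x) * esqrt (emeasure \<nu> A)" by simp
  qed
  finally show ?thesis .
qed

text \<open>Write \<open>w\<close> for the square root of the prior mass of \<open>A\<close> and \<open>W\<close> for that of its evidence. Where
\<open>4 * W \<le> w\<close> one has \<open>(w - W)\<^sup>2 \<ge> 9 / 16 * w\<^sup>2\<close>, while the expectation of \<open>(w - W)\<^sup>2\<close> is at most
\<open>2 * w\<^sup>2 * (1 - (1 - \<epsilon>\<^sup>2) ^ n) \<le> 2 * w\<^sup>2 * n * \<epsilon>\<^sup>2\<close>.\<close>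

lemma evidence_lower_bound:
  assumes A [measurable]: "A \<in> sets \<nu>" and near: "A \<subseteq> mcball s \<epsilon>" and \<epsilon>: "0 \<le> \<epsilon>" "real n * \<epsilon>\<^sup>2 \<le> 1" "\<epsilon> \<le> 1"
    and pos: "0 < measure \<nu> A"
  shows "measure (sample_law n) {x \<in> space (sample_law n). 16 * evidence n A x \<le> emeasure \<nu> A}
    \<le> 32 / 9 * (real n * \<epsilon>\<^sup>2)"
proof -
  interpret X: prob_space "sample_law n" by (rule prob_space_sample_law)
  define v where "v = measure \<nu> A"
  have v: "emeasure \<nu> A = ennreal v" "0 < v" using pos by (simp_all add: v_def prior.emeasure_eq_measure)
  define bad where "bad = {x \<in> space (sample_law n). 16 * evidence n A x \<le> ennreal v}"
  have [measurable]: "bad \<in> sets (sample_law n)" unfolding bad_def by measurable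
  define W where "W = (\<lambda>x. esqrt (evidence n A x) * esqrt (ennreal v))"
  have [measurable]: "W \<in> borel_measurable (sample_law n)" unfolding W_def by measurable
  \<comment> \<open>The bound for \<open>(w - W)\<^sup>2\<close>, multiplied by 16 and with its mixed term moved to the left.\<close>
  have pointwise: "9 * ennreal v * indicator bad x + 32 * W x \<le> 16 * ennreal v + 16 * evidence n A x"
    if x: "x \<in> space (sample_law n)" for x
  proof (cases "evidence n A x")
    case (real e)
    define a b where "a = sqrt e" and "b = sqrt v"
    have ab: "0 \<le> a" "0 \<le> b" "e = a\<^sup>2" "v = b\<^sup>2" using real v by (simp_all add: a_def b_def)
    have W: "W x = ennreal (a * b)" using real v by (simp add: W_def a_def b_def ennreal_mult)
    show ?thesis
    proof (cases "x \<in> bad")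
      case True
      then have "16 * e \<le> v"
        using real v by (simp add: bad_def ennreal_mult[symmetric] flip: ennreal_numeral)
      then have "(4 * a)\<^sup>2 \<le> b\<^sup>2" by (simp add: ab power_mult_distrib)
      then have "4 * a \<le> b" using ab by (intro power2_le_imp_le[of "4 * a"]) auto
      then have "0 \<le> (b - 4 * a) * (7 * b - 4 * a)" using ab by (intro mult_nonneg_nonneg) auto
      then have "9 * v + 32 * (a * b) \<le> 16 * v + 16 * e"
        by (simp add: ab algebra_simps power2_eq_square)
      then show ?thesis using True real v ab W
        by (simp add: ennreal_mult[symmetric] flip: ennreal_numeral ennreal_plus)
    next
      case False
      have "32 * (a * b) \<le> 16 * v + 16 * e" using sum_squares_bound[of a b] by (simp add: ab)
      then show ?thesis using False real v ab W
        by (simp add: ennreal_mult[symmetric] flip: ennreal_numeral ennreal_plus)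
    qed
  qed (simp add: ennreal_mult_top)
  have "9 * ennreal v * emeasure (sample_law n) bad + 32 * (\<integral>\<^sup>+x. W x \<partial>sample_law n)
      = (\<integral>\<^sup>+x. 9 * ennreal v * indicator bad x + 32 * W x \<partial>sample_law n)"
    by (subst nn_integral_add) (auto simp: nn_integral_cmult)
  also have "\<dots> \<le> (\<integral>\<^sup>+x. 16 * ennreal v + 16 * evidence n A x \<partial>sample_law n)"
    by (intro nn_integral_mono pointwise)
  also have "\<dots> = 16 * ennreal v + 16 * (\<integral>\<^sup>+x. evidence n A x \<partial>sample_law n)"
    by (simp add: nn_integral_add nn_integral_cmult X.emeasure_space_1)
  also have "\<dots> \<le> 16 * ennreal v + 16 * ennreal v"
    using evidence_integral_le[OF A, of n] v by (intro add_left_mono mult_left_mono) auto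
  finally have upper: "9 * ennreal v * emeasure (sample_law n) bad + 32 * (\<integral>\<^sup>+x. W x \<partial>sample_law n)
      \<le> 16 * ennreal v + 16 * ennreal v" .
  have "1 - real n * \<epsilon>\<^sup>2 \<le> (1 - \<epsilon>\<^sup>2) ^ n"
    using Bernoulli_inequality[of "- \<epsilon>\<^sup>2" n] \<epsilon> by (simp add: power_le_one)
  then have "ennreal ((1 - real n * \<epsilon>\<^sup>2) * v) \<le> ennreal ((1 - \<epsilon>\<^sup>2) ^ n * v)"
    using v by (intro ennreal_leI mult_right_mono) auto
  also have "\<dots> \<le> (\<integral>\<^sup>+x. W x \<partial>sample_law n)"
    using evidence_sqrt_integral_ge[OF A near \<epsilon>(1,3), of n] v \<epsilon>
    by (simp add: W_def ennreal_mult power_le_one)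
  finally have lower: "ennreal ((1 - real n * \<epsilon>\<^sup>2) * v) \<le> (\<integral>\<^sup>+x. W x \<partial>sample_law n)" .
  have "9 * ennreal v * emeasure (sample_law n) bad + 32 * ennreal ((1 - real n * \<epsilon>\<^sup>2) * v)
      \<le> 16 * ennreal v + 16 * ennreal v"
    by (rule order_trans[OF add_left_mono[OF mult_left_mono[OF lower]] upper]) simp
  then have "9 * v * measure (sample_law n) bad + 32 * ((1 - real n * \<epsilon>\<^sup>2) * v) \<le> 16 * v + 16 * v"
    using v \<epsilon> by (simp add: X.emeasure_eq_measure ennreal_mult[symmetric] flip: ennreal_numeral ennreal_plus)
  then have "v * (9 * measure (sample_law n) bad) \<le> v * (32 * (real n * \<epsilon>\<^sup>2))" by (simp add: algebra_simps)
  then have "9 * measure (sample_law n) bad \<le> 32 * (real n * \<epsilon>\<^sup>2)"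
    using v(2) by (simp only: mult_le_cancel_left_pos)
  then show ?thesis by (simp add: bad_def v)
qed

lemma evidence_sqrt_ball_le:
  assumes A [measurable]: "A \<in> sets \<nu>" and sub: "A \<subseteq> mcball u x"
    and u: "u \<in> S" and r: "r \<le> hdist \<mu> f s u" "0 \<le> r" and x: "0 \<le> x" "x \<le> 1"
  shows "(\<integral>\<^sup>+z. esqrt (evidence n A z) \<partial>sample_law n)
      \<le> ennreal (1 - (r\<^sup>2 / 2 - x\<^sup>2)) ^ n * esqrt (emeasure \<nu> A)"
proof -
  have "(\<integral>\<^sup>+z. esqrt (\<integral>\<^sup>+t. (\<Prod>i<n. likelihood_ratio s t (z i)) * indicator A t \<partial>\<nu>)
          \<partial>(\<Pi>\<^sub>M i\<in>{..<n}. model \<mu> f s))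
      \<le> ennreal (1 - (r\<^sup>2 / 2 - x\<^sup>2)) ^ n * esqrt (\<integral>\<^sup>+t. indicator A t \<partial>\<nu>)"
  proof (rule tensorized_mixture_affinity_le[where B="mcball u x"])
    show "(\<integral>\<^sup>+y. esqrt (\<integral>\<^sup>+t. likelihood_ratio s t y * w t \<partial>\<nu>) \<partial>model \<mu> f s)
        \<le> ennreal (1 - (r\<^sup>2 / 2 - x\<^sup>2)) * esqrt (\<integral>\<^sup>+t. w t \<partial>\<nu>)"
      if "w \<in> borel_measurable \<nu>" "\<And>t. t \<in> space \<nu> \<Longrightarrow> t \<notin> mcball u x \<Longrightarrow> w t = 0" for w
      by (rule ball_mixture_affinity_le[OF u r x that])
    show "prob_space (model \<mu> f s)" "sigma_finite_measure \<nu>" by unfold_locales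
    show "indicator A t = (0::ennreal)" if "t \<notin> mcball u x" for t
      using that sub by (auto simp: indicator_def)
  qed measurable
  then show ?thesis by (simp add: evidence_def sample_ratio_def sample_law_def)
qed

lemma evidence_subadditive:
  assumes I: "finite I" and A [measurable]: "\<And>i. i \<in> I \<Longrightarrow> A i \<in> sets \<nu>"
    and B: "B \<in> sets \<nu>" "B \<subseteq> (\<Union>i\<in>I. A i)" and z: "z \<in> space (sample_law n)"
  shows "evidence n B z \<le> (\<Sum>i\<in>I. evidence n (A i) z)"
proof -
  note [measurable] = measurable_sample_ratio_snd[OF z]
  have "evidence n B z \<le> (\<integral>\<^sup>+t. (\<Sum>i\<in>I. sample_ratio n z t * indicator (A i) t) \<partial>\<nu>)"
    unfolding evidence_def
  proof (rule nn_integral_mono)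
    fix t
    show "sample_ratio n z t * indicator B t \<le> (\<Sum>i\<in>I. sample_ratio n z t * indicator (A i) t)"
    proof (cases "t \<in> B")
      case True
      with B obtain i where i: "i \<in> I" "t \<in> A i" by blast
      have "sample_ratio n z t * indicator B t = sample_ratio n z t * indicator (A i) t"
        using True i by (simp add: indicator_def)
      also have "\<dots> \<le> (\<Sum>i\<in>I. sample_ratio n z t * indicator (A i) t)"
        by (rule member_le_sum[OF i(1)]) (use I in auto)
      finally show ?thesis .
    qed simp
  qed
  also have "\<dots> = (\<Sum>i\<in>I. evidence n (A i) z)"
    unfolding evidence_def by (rule nn_integral_sum) measurable
  finally show ?thesis .
qed

text \<open>The centres of the covering balls are taken in \<open>A\<close> itself, so they keep the distance \<open>r\<close> from \<open>s\<close>; the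
square root is subadditive, so the bounds for the pieces add up.\<close>

lemma evidence_sqrt_shell_le:
  assumes A [measurable]: "A \<in> sets \<nu>" and far: "\<And>t. t \<in> A \<Longrightarrow> r \<le> hdist \<mu> f s t"
    and r: "0 \<le> r" "r \<le> 1" and x: "0 \<le> x" "x \<le> r / 2"
    and entropy: "\<And>N. N \<subseteq> A \<Longrightarrow> separated (hdist \<mu> f) x N \<Longrightarrow> finite N \<and> real (card N) \<le> K"
  shows "(\<integral>\<^sup>+z. esqrt (evidence n A z) \<partial>sample_law n)
      \<le> ennreal (K * (1 - r\<^sup>2 / 4) ^ n) * esqrt (emeasure \<nu> A)"
proof -
  have AS: "A \<subseteq> S" using sets.sets_into_space[OF A] by simp
  have refl: "hdist \<mu> f t t \<le> x" if "t \<in> A" for t using that AS x by auto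
  obtain N where N: "N \<subseteq> A" "finite N" "real (card N) \<le> K"
    and cov: "\<And>t. t \<in> A \<Longrightarrow> \<exists>u\<in>N. hdist \<mu> f u t \<le> x"
    by (rule separated_cover[of A "hdist \<mu> f" x K, OF entropy commute refl]) blast+
  have cover: "A \<subseteq> (\<Union>u\<in>N. mcball u x)" using cov N AS by fastforce
  have r2: "r\<^sup>2 \<le> 1" using r by (simp add: power_le_one)
  have "x\<^sup>2 \<le> r\<^sup>2 / 4" using power_mono[OF x(2) x(1), of 2] by (simp add: power_divide)
  then have a: "ennreal (1 - (r\<^sup>2 / 2 - x\<^sup>2)) \<le> ennreal (1 - r\<^sup>2 / 4)" by (intro ennreal_leI) simp
  have ball: "(\<integral>\<^sup>+z. esqrt (evidence n (A \<inter> mcball u x) z) \<partial>sample_law n)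
      \<le> ennreal (1 - r\<^sup>2 / 4) ^ n * esqrt (emeasure \<nu> A)" if u: "u \<in> N" for u
  proof -
    have "(\<integral>\<^sup>+z. esqrt (evidence n (A \<inter> mcball u x) z) \<partial>sample_law n)
      \<le> ennreal (1 - (r\<^sup>2 / 2 - x\<^sup>2)) ^ n * esqrt (emeasure \<nu> (A \<inter> mcball u x))"
      by (rule evidence_sqrt_ball_le) (use u N AS far x r in auto)
    also have "\<dots> \<le> ennreal (1 - r\<^sup>2 / 4) ^ n * esqrt (emeasure \<nu> A)"
      by (intro mult_mono power_mono a esqrt_mono emeasure_mono) auto
    finally show ?thesis .
  qed
  have "(\<integral>\<^sup>+z. esqrt (evidence n A z) \<partial>sample_law n)
      \<le> (\<integral>\<^sup>+z. (\<Sum>u\<in>N. esqrt (evidence n (A \<inter> mcball u x) z)) \<partial>sample_law n)"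
    using cover
    by (intro nn_integral_mono order_trans[OF esqrt_mono esqrt_sum_le] evidence_subadditive N) auto
  also have "\<dots> = (\<Sum>u\<in>N. \<integral>\<^sup>+z. esqrt (evidence n (A \<inter> mcball u x) z) \<partial>sample_law n)"
    by (rule nn_integral_sum) measurable
  also have "\<dots> \<le> (\<Sum>u\<in>N. ennreal (1 - r\<^sup>2 / 4) ^ n * esqrt (emeasure \<nu> A))"
    by (rule sum_mono) (rule ball)
  also have "\<dots> = ennreal (real (card N)) * ennreal ((1 - r\<^sup>2 / 4) ^ n) * esqrt (emeasure \<nu> A)"
    using r2 by (simp add: ennreal_power ennreal_of_nat_eq_real_of_nat mult.assoc)
  also have "\<dots> \<le> ennreal K * ennreal ((1 - r\<^sup>2 / 4) ^ n) * esqrt (emeasure \<nu> A)"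
    by (intro mult_right_mono ennreal_leI N) auto
  also have "ennreal K * ennreal ((1 - r\<^sup>2 / 4) ^ n) = ennreal (K * (1 - r\<^sup>2 / 4) ^ n)"
    using r2 N by (subst ennreal_mult) auto
  finally show ?thesis .
qed

end

section \<open>Concentration of the posterior\<close>

lemma esqrt_markov:
  assumes M: "finite_measure M" and g [measurable]: "g \<in> borel_measurable M"
    and I: "(\<integral>\<^sup>+x. esqrt (g x) \<partial>M) \<le> ennreal b" and a: "0 < a" and b: "0 \<le> b"
  shows "measure M {x \<in> space M. ennreal a \<le> g x} \<le> b / sqrt a"
proof -
  interpret finite_measure M by fact
  have "emeasure M {x \<in> space M. ennreal a \<le> g x}
      \<le> emeasure M {x \<in> space M. 1 \<le> ennreal (1 / sqrt a) * esqrt (g x)}"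
  proof (rule emeasure_mono)
    show "{x \<in> space M. ennreal a \<le> g x} \<subseteq> {x \<in> space M. 1 \<le> ennreal (1 / sqrt a) * esqrt (g x)}"
    proof safe
      fix x assume "ennreal a \<le> g x"
      then have "ennreal (sqrt a) \<le> esqrt (g x)" using esqrt_mono[of "ennreal a" "g x"] a by simp
      then have "ennreal (1 / sqrt a) * ennreal (sqrt a) \<le> ennreal (1 / sqrt a) * esqrt (g x)"
        by (intro mult_left_mono) auto
      then show "1 \<le> ennreal (1 / sqrt a) * esqrt (g x)"
        using a by (simp add: ennreal_mult[symmetric])
    qed
  qed measurable
  also have "\<dots> \<le> ennreal (1 / sqrt a) * (\<integral>\<^sup>+x. esqrt (g x) * indicator (space M) x \<partial>M)"
    using nn_integral_Markov_inequality[of "\<lambda>x. esqrt (g x)" "space M" M "ennreal (1 / sqrt a)"] by simp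
  also have "(\<integral>\<^sup>+x. esqrt (g x) * indicator (space M) x \<partial>M) = (\<integral>\<^sup>+x. esqrt (g x) \<partial>M)"
    by (rule nn_integral_cong) simp
  also have "ennreal (1 / sqrt a) * (\<integral>\<^sup>+x. esqrt (g x) \<partial>M) \<le> ennreal (1 / sqrt a) * ennreal b"
    by (intro mult_left_mono I) auto
  also have "\<dots> = ennreal (b / sqrt a)" using a b by (simp add: ennreal_mult[symmetric])
  finally show ?thesis using a b by (simp add: emeasure_eq_measure)
qed

text \<open>Already the second term is at most \<open>1 / 16 ^ 3\<close> times the first.\<close>

lemma sum_exp_quadrupling_le:
  fixes y :: "nat \<Rightarrow> real"
  assumes y: "\<And>i. y (Suc i) = 4 * y i" and big: "ln 16 \<le> y k"
  shows "(\<Sum>i=k..<k + m. exp (- y i)) \<le> 1.05 * exp (- y k)"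
  using big
proof (induction m arbitrary: k)
  case (Suc m)
  have yk: "0 \<le> y k" using Suc.prems by (rule order_trans[rotated]) simp
  have e: "exp (- y k) \<le> 1 / 16"
    using Suc.prems by (metis exp_le_cancel_iff exp_ln exp_minus inverse_eq_divide neg_le_iff_le zero_less_numeral)
  have "{k..<k + Suc m} = insert k {Suc k..<Suc k + m}" by auto
  then have "(\<Sum>i=k..<k + Suc m. exp (- y i)) = exp (- y k) + (\<Sum>i=Suc k..<Suc k + m. exp (- y i))"
    by simp
  also have "\<dots> \<le> exp (- y k) + 1.05 * exp (- y (Suc k))"
    using Suc.IH[of "Suc k"] Suc.prems yk by (simp add: y)
  also have "exp (- y (Suc k)) \<le> exp (- y k + - y k + - y k)" using yk by (simp add: y)
  also have "\<dots> \<le> exp (- y k) * (1 / 16) * (1 / 16)"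
    unfolding exp_add using e by (intro mult_mono) auto
  also have "exp (- y k) + 1.05 * (exp (- y k) * (1 / 16) * (1 / 16)) \<le> 1.05 * exp (- y k)"
    using exp_gt_zero[of "- y k"] by simp
  finally show ?case by simp
qed simp

text \<open>The condition defining \<open>J\<^sub>2\<close> holds for all large indices since \<open>\<gamma> < 4\<close>, so that the least index exists. It
persists from each index to the next: the left-hand side is multiplied by 4, the right-hand side by at most
\<open>\<gamma>\<close>.\<close>

lemma threshold_persists:
  fixes \<gamma> b D x :: real
  assumes \<gamma>: "1 \<le> \<gamma>" "\<gamma> < 4" and b: "0 \<le> b" and D: "0 \<le> D" and x: "0 < x" "x \<le> 8"
    and k: "J\<^sub>2 \<gamma> b D x \<le> k"
  shows "\<gamma> ^ (k + 2) * b / 3 \<le> 4 powr (real k - 4) * x\<^sup>2"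
    and "D \<le> 4 powr (real k - 4) * x\<^sup>2" and "ln (8 / x) \<le> 4 powr (real k - 4) * x\<^sup>2"
proof -
  define P where "P = (\<lambda>j. 0 < j \<and> 4 powr (real j - 4) * x\<^sup>2 \<ge> Max {\<gamma> ^ (j + 2) * b / 3, D, ln (8 / x)})"
  have J: "J\<^sub>2 \<gamma> b D x = (LEAST j. P j)" by (simp add: J\<^sub>2_def P_def)
  have pw: "4 powr (real j - 4) = 4 ^ j / 256" for j
    by (simp add: powr_diff powr_realpow)
  have lim: "(\<lambda>j. (\<gamma> / 4) ^ j * (\<gamma>\<^sup>2 * b / 3) + (1 / 4) ^ j * (D + ln (8 / x))) \<longlonglongrightarrow> 0 * (\<gamma>\<^sup>2 * b / 3) + 0 * (D + ln (8 / x))"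
    using \<gamma> by (intro tendsto_intros LIMSEQ_realpow_zero) auto
  have "\<forall>\<^sub>F j in sequentially. (\<gamma> / 4) ^ j * (\<gamma>\<^sup>2 * b / 3) + (1 / 4) ^ j * (D + ln (8 / x)) < x\<^sup>2 / 256"
    using order_tendstoD(2)[OF lim, of "x\<^sup>2 / 256"] x by simp
  moreover have "\<forall>\<^sub>F j::nat in sequentially. 0 < j" by (rule eventually_gt_at_top)
  ultimately have "\<forall>\<^sub>F j in sequentially. P j"
  proof eventually_elim
    case (elim j)
    have "4 ^ j * ((\<gamma> / 4) ^ j * (\<gamma>\<^sup>2 * b / 3) + (1 / 4) ^ j * (D + ln (8 / x))) \<le> 4 ^ j * (x\<^sup>2 / 256)"
      using elim(1) by (intro mult_left_mono) auto
    then have "\<gamma> ^ (j + 2) * b / 3 + (D + ln (8 / x)) \<le> 4 powr (real j - 4) * x\<^sup>2"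
      by (simp add: pw power_divide power_add power_one_over distrib_left) (simp add: algebra_simps power2_eq_square)
    moreover have "0 \<le> \<gamma> ^ (j + 2) * b / 3" "0 \<le> ln (8 / x)" using \<gamma> b x by auto
    ultimately show ?case using elim(2) D by (simp add: P_def)
  qed
  then have "\<exists>j. P j" by (auto dest: eventually_happens)
  then have least: "P (J\<^sub>2 \<gamma> b D x)" unfolding J by (rule LeastI_ex)
  have "P k" using k
  proof (induction k rule: dec_induct)
    case (step j)
    have "4 powr (real (Suc j) - 4) = 4 * 4 powr (real j - 4)" unfolding pw by simp
    moreover have "\<gamma> ^ (Suc j + 2) * b / 3 \<le> 4 * (\<gamma> ^ (j + 2) * b / 3)"
      using mult_right_mono[of \<gamma> 4 "\<gamma> ^ (j + 2) * b / 3"] \<gamma> b by (simp add: mult.assoc)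
    moreover have "0 \<le> ln (8 / x)" using x by simp
    ultimately show ?case using step.IH D by (simp add: P_def)
  qed (rule least)
  then show "\<gamma> ^ (k + 2) * b / 3 \<le> 4 powr (real k - 4) * x\<^sup>2"
    and "D \<le> 4 powr (real k - 4) * x\<^sup>2" and "ln (8 / x) \<le> 4 powr (real k - 4) * x\<^sup>2"
    by (simp_all add: P_def)
qed

context bayes_model
begin

text \<open>The expected square root of the evidence of \<open>A\<close> is at most \<open>exp (y - 64 * y + 6 * y) * sqrt v\<close>: the
exponents come from the number of balls, from the decay \<open>exp (- n * r\<^sup>2 / 4)\<close> and from the square root of
the prior mass. By Markov's inequality the threshold costs a factor \<open>4 * exp (y / 2)\<close>, which is negligible
against the remaining decay.\<close>

lemma evidence_shell_probability_le:
  fixes K v y :: real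
  assumes A [measurable]: "A \<in> sets \<nu>" and far: "\<And>t. t \<in> A \<Longrightarrow> r \<le> hdist \<mu> f s t"
    and r: "0 \<le> r" "r \<le> 1" and x: "0 \<le> x" "x \<le> r / 2"
    and y: "ln 16 \<le> y" "real n * r\<^sup>2 = 256 * y"
    and entropy: "\<And>N. N \<subseteq> A \<Longrightarrow> separated (hdist \<mu> f) x N \<Longrightarrow> finite N \<and> real (card N) \<le> exp y"
    and v: "0 < v" and mass: "measure \<nu> A \<le> exp (12 * y) * v"
  shows "measure (sample_law n) {z \<in> space (sample_law n). ennreal (v * exp (- y) / 16) \<le> evidence n A z}
    \<le> exp (- y)"
proof -
  interpret X: prob_space "sample_law n" by (rule prob_space_sample_law)
  have y0: "0 \<le> y" using y(1) by (rule order_trans[rotated]) simp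
  have r2: "r\<^sup>2 \<le> 1" using r by (simp add: power_le_one)
  have "(1 - r\<^sup>2 / 4) ^ n \<le> exp (- (r\<^sup>2 / 4)) ^ n"
    using exp_ge_add_one_self[of "- (r\<^sup>2 / 4)"] r2 by (intro power_mono) auto
  also have "\<dots> = exp (- (64 * y))"
    using y(2) by (simp add: exp_of_nat_mult[symmetric])
  finally have decay: "(1 - r\<^sup>2 / 4) ^ n \<le> exp (- (64 * y))" .
  have "(\<integral>\<^sup>+z. esqrt (evidence n A z) \<partial>sample_law n)
      \<le> ennreal (exp y * (1 - r\<^sup>2 / 4) ^ n) * esqrt (emeasure \<nu> A)"
    by (rule evidence_sqrt_shell_le[OF A far r x entropy])
  also have "\<dots> \<le> ennreal (exp y * exp (- (64 * y))) * ennreal (exp (6 * y) * sqrt v)"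
  proof (intro mult_mono ennreal_leI mult_left_mono decay)
    have "sqrt (measure \<nu> A) \<le> sqrt (exp (12 * y) * v)" using mass by simp
    also have "\<dots> = exp (6 * y) * sqrt v"
      using exp_double[of "6 * y"] by (simp add: real_sqrt_mult)
    finally show "esqrt (emeasure \<nu> A) \<le> ennreal (exp (6 * y) * sqrt v)"
      by (simp add: prior.emeasure_eq_measure ennreal_leI)
  qed (use r2 in auto)
  also have "\<dots> = ennreal (exp (- (57 * y)) * sqrt v)"
  proof -
    have "exp y * exp (- (64 * y)) * (exp (6 * y) * sqrt v) = exp (y + - (64 * y) + 6 * y) * sqrt v"
      by (simp only: exp_add mult.assoc)
    then show ?thesis using v by (simp add: ennreal_mult[symmetric])
  qed
  finally have "(\<integral>\<^sup>+z. esqrt (evidence n A z) \<partial>sample_law n) \<le> ennreal (exp (- (57 * y)) * sqrt v)" .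
  then have "measure (sample_law n) {z \<in> space (sample_law n). ennreal (v * exp (- y) / 16) \<le> evidence n A z}
      \<le> exp (- (57 * y)) * sqrt v / sqrt (v * exp (- y) / 16)"
    using v by (intro esqrt_markov X.finite_measure_axioms) auto
  also have "\<dots> = 4 * exp (- (57 * y)) / exp (- (y / 2))"
  proof -
    have "sqrt (v * exp (- y) / 16) = sqrt v * exp (- (y / 2)) / 4"
      using exp_double[of "- (y / 2)"] by (simp add: real_sqrt_divide real_sqrt_mult)
    then show ?thesis using v by (simp only:) (simp add: field_simps)
  qed
  also have "\<dots> = 4 * exp (- (57 * y) - - (y / 2))"
    by (simp only: exp_diff)
  also have "\<dots> \<le> 4 * exp (- y + - y)" using y0 by simp
  also have "\<dots> = 4 * exp (- y) * exp (- y)" by (simp only: exp_add mult.assoc)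
  also have "\<dots> \<le> exp (- y)"
  proof -
    have "exp (- y) \<le> 1 / 16"
      using y by (metis exp_le_cancel_iff exp_ln exp_minus inverse_eq_divide neg_le_iff_le zero_less_numeral)
    then show ?thesis using mult_right_mono[of "4 * exp (- y)" 1 "exp (- y)"] by simp
  qed
  finally show ?thesis .
qed

text \<open>The exceptional event consists of the samples with small evidence near \<open>s\<close>, of probability at most
\<open>4 / 9 * c\<close>, and of those with large evidence in some shell, of total probability at most
\<open>1.05 * c / 8\<close>. The radii grow geometrically and Hellinger distances are at most one, so finitely many shells
exhaust the complement of a ball.\<close>

lemma evidence_concentration:
  fixes c \<epsilon> :: real and J n :: nat
  defines "r \<equiv> \<lambda>i. 2 ^ i * c / sqrt (real n)" and "y \<equiv> \<lambda>i. 4 powr (real i - 4) * c\<^sup>2"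
  assumes n: "0 < n" and c: "0 < c" "c \<le> 1 / 2"
    and y: "\<And>i. J \<le> i \<Longrightarrow> ln (8 / c) \<le> y i"
    and \<epsilon>: "0 \<le> \<epsilon>" "\<epsilon> \<le> c / (2 * sqrt (real n))" and pos: "0 < measure \<nu> (mcball s \<epsilon>)"
    and mass: "\<And>i. J \<le> i \<Longrightarrow> measure \<nu> (mcball s (r (Suc i))) \<le> exp (12 * y i) * measure \<nu> (mcball s \<epsilon>)"
    and entropy: "\<And>i N. J \<le> i \<Longrightarrow> N \<subseteq> mcball s (r (Suc i)) \<Longrightarrow>
        separated (hdist \<mu> f) (min (r i / 2) (1 / 4)) N \<Longrightarrow> finite N \<and> real (card N) \<le> exp (y i)"
  obtains bad where "bad \<in> sets (sample_law n)" "measure (sample_law n) bad \<le> c"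
    "\<And>x k. x \<in> space (sample_law n) - bad \<Longrightarrow> J \<le> k \<Longrightarrow> 0 < evidence n S x \<and>
      evidence n (S - mcball s (r k)) x \<le> ennreal (1.05 * exp (- y k)) * evidence n S x"
proof -
  interpret X: prob_space "sample_law n" by (rule prob_space_sample_law)
  have y_Suc: "y (Suc i) = 4 * y i" for i
  proof -
    have "4 powr (real (Suc i) - 4) = 4 powr (1 + (real i - 4))" by (simp add: algebra_simps)
    then show ?thesis by (simp only: powr_add y_def) simp
  qed
  have ny: "real n * (r i)\<^sup>2 = 256 * y i" for i
  proof -
    have "(2 ^ i)\<^sup>2 = (4 ^ i :: real)" by (simp add: power2_eq_square flip: power_mult_distrib)
    then show ?thesis
      using n by (simp add: r_def y_def power_mult_distrib power_divide powr_diff powr_realpow)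
  qed
  have y16: "ln 16 \<le> y i" if "J \<le> i" for i
  proof -
    have "16 \<le> 8 / c" using c by (simp add: field_simps)
    then have "ln 16 \<le> ln (8 / c)" using c by simp
    then show ?thesis using y[OF that] by simp
  qed
  define v where "v = measure \<nu> (mcball s \<epsilon>)"
  obtain I where I: "\<not> r I < 1" "\<And>i. i < I \<Longrightarrow> r i < 1"
  proof -
    have "0 < c / sqrt (real n)" using n c by simp
    then obtain k where "1 / (c / sqrt (real n)) < 2 ^ k" using real_arch_pow[of 2] by auto
    then have "\<not> r k < 1" using n c by (simp add: r_def field_simps)
    then have "\<not> r (LEAST k. \<not> r k < 1) < 1" by (rule LeastI)
    moreover have "r i < 1" if "i < (LEAST k. \<not> r k < 1)" for i using not_less_Least[OF that] by blast
    ultimately show thesis using that by blast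
  qed
  define shell where "shell = (\<lambda>i. mcball s (r (Suc i)) - mcball s (r i))"
  have shell_sets [measurable]: "shell i \<in> sets \<nu>" for i unfolding shell_def by measurable
  define bad0 where "bad0 = {x \<in> space (sample_law n). 16 * evidence n (mcball s \<epsilon>) x \<le> emeasure \<nu> (mcball s \<epsilon>)}"
  define bad1 where "bad1 = (\<lambda>i. {x \<in> space (sample_law n). ennreal (v * exp (- y i) / 16) \<le> evidence n (shell i) x})"
  have [measurable]: "bad0 \<in> sets (sample_law n)" "bad1 i \<in> sets (sample_law n)" for i
    unfolding bad0_def bad1_def by measurable
  define bad where "bad = bad0 \<union> (\<Union>i\<in>{J..<J + (I - J)}. bad1 i)"
  have n\<epsilon>: "real n * \<epsilon>\<^sup>2 \<le> c\<^sup>2 / 4"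
  proof -
    have "\<epsilon>\<^sup>2 \<le> (c / (2 * sqrt (real n)))\<^sup>2" using \<epsilon> by (intro power_mono)
    then show ?thesis using n by (simp add: power_divide power_mult_distrib field_simps)
  qed
  have c2: "c\<^sup>2 \<le> c / 2" using c by (simp add: power2_eq_square field_simps)
  have "\<epsilon> \<le> c / (2 * 1)"
    by (rule order_trans[OF \<epsilon>(2)]) (use n c in \<open>intro divide_left_mono; simp\<close>)
  then have "\<epsilon> \<le> 1" using c by simp
  have p0: "measure (sample_law n) bad0 \<le> 4 / 9 * c"
  proof -
    have "measure (sample_law n) bad0 \<le> 32 / 9 * (real n * \<epsilon>\<^sup>2)"
      unfolding bad0_def
      by (rule evidence_lower_bound[OF mcball_in_prior order_refl \<epsilon>(1) _ \<open>\<epsilon> \<le> 1\<close> pos])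
         (use n\<epsilon> c2 c in simp)
    also have "\<dots> \<le> 4 / 9 * c" using n\<epsilon> c2 by simp
    finally show ?thesis .
  qed
  have p1: "measure (sample_law n) (bad1 i) \<le> exp (- y i)" if i: "J \<le> i" "i < I" for i
    unfolding bad1_def
  proof (rule evidence_shell_probability_le[where r="r i" and x="min (r i / 2) (1 / 4)"])
    show "r i \<le> hdist \<mu> f s t" if "t \<in> shell i" for t using that by (auto simp: shell_def)
    show "0 \<le> r i" using c by (simp add: r_def)
    then show "0 \<le> min (r i / 2) (1 / 4)" by simp
    show "r i \<le> 1" using I(2)[OF i(2)] by simp
    show "measure \<nu> (shell i) \<le> exp (12 * y i) * v"
      using mass[OF i(1)] prior.finite_measure_mono[of "shell i" "mcball s (r (Suc i))"]
      by (auto simp: shell_def v_def intro: order_trans)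
    show "finite N \<and> real (card N) \<le> exp (y i)"
      if "N \<subseteq> shell i" "separated (hdist \<mu> f) (min (r i / 2) (1 / 4)) N" for N
      using entropy[OF i(1) _ that(2)] that(1) by (auto simp: shell_def)
  qed (use pos y16 ny i in \<open>auto simp: v_def\<close>)
  have "measure (sample_law n) bad \<le> measure (sample_law n) bad0 + measure (sample_law n) (\<Union>i\<in>{J..<J + (I - J)}. bad1 i)"
    unfolding bad_def by (rule measure_Un_le) auto
  also have "measure (sample_law n) (\<Union>i\<in>{J..<J + (I - J)}. bad1 i) \<le> (\<Sum>i\<in>{J..<J + (I - J)}. measure (sample_law n) (bad1 i))"
    by (rule measure_UNION_le) auto
  also have "\<dots> \<le> (\<Sum>i\<in>{J..<J + (I - J)}. exp (- y i))"
    by (intro sum_mono p1) auto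
  also have "\<dots> \<le> 1.05 * exp (- y J)"
    by (rule sum_exp_quadrupling_le[of y, OF y_Suc y16]) simp
  also have "exp (- y J) \<le> c / 8"
  proof -
    have "exp (- y J) \<le> exp (- ln (8 / c))" using y[of J] by simp
    also have "\<dots> = c / 8" using c by (simp add: exp_minus)
    finally show ?thesis .
  qed
  finally have "measure (sample_law n) bad \<le> c" using p0 c by simp
  moreover have "0 < evidence n S x \<and>
      evidence n (S - mcball s (r k)) x \<le> ennreal (1.05 * exp (- y k)) * evidence n S x"
    if x: "x \<in> space (sample_law n) - bad" and k: "J \<le> k" for x k
  proof -
    have "ennreal v < 16 * evidence n (mcball s \<epsilon>) x"
      using x by (auto simp: bad_def bad0_def v_def prior.emeasure_eq_measure)
    also have "\<dots> \<le> 16 * evidence n S x"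
      unfolding evidence_def by (intro mult_left_mono nn_integral_mono) (auto simp: indicator_def)
    finally have low: "ennreal v < 16 * evidence n S x" .
    then have "0 < evidence n S x" by (cases "evidence n S x = 0") (auto simp: zero_less_iff_neq_zero)
    have "evidence n (S - mcball s (r k)) x \<le> (\<Sum>i=k..<k + (I - k). evidence n (shell i) x)"
    proof (rule evidence_subadditive)
      show "S - mcball s (r k) \<subseteq> (\<Union>i\<in>{k..<k + (I - k)}. shell i)"
      proof
        fix t assume t: "t \<in> S - mcball s (r k)"
        let ?out = "\<lambda>i. t \<notin> mcball s (r i)"
        have in_I: "\<not> ?out I" using t s I(1) hellinger_affinity_model(2)[OF s, of t] by auto
        have "k < I"
        proof (rule ccontr)
          assume "\<not> k < I"
          then have "r I \<le> r k" using c by (auto simp: r_def intro!: divide_right_mono mult_right_mono)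
          then show False using in_I t by auto
        qed
        \<comment> \<open>The first of the balls that contains \<open>t\<close>.\<close>
        define m where "m = (LEAST m. \<not> ?out (k + m))"
        have "\<not> ?out (k + (I - k))" using in_I \<open>k < I\<close> by simp
        then have m: "\<not> ?out (k + m)" and "m \<le> I - k"
          unfolding m_def by (rule LeastI, rule Least_le)
        have "m \<noteq> 0" using m t by (cases m) auto
        then obtain m' where m': "m = Suc m'" by (cases m) auto
        have "?out (k + m')" using not_less_Least[of m' "\<lambda>m. \<not> ?out (k + m)"] m' by (auto simp: m_def)
        then have "t \<in> shell (k + m')" using m m' by (simp add: shell_def)
        moreover have "k + m' \<in> {k..<k + (I - k)}" using \<open>m \<le> I - k\<close> m' by simp
        ultimately show "t \<in> (\<Union>i\<in>{k..<k + (I - k)}. shell i)" by blast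
      qed
    qed (use x in auto)
    also have "\<dots> \<le> (\<Sum>i=k..<k + (I - k). ennreal (v * exp (- y i) / 16))"
    proof (rule sum_mono)
      fix i assume i: "i \<in> {k..<k + (I - k)}"
      then have "x \<notin> bad1 i" using x k by (auto simp: bad_def)
      then show "evidence n (shell i) x \<le> ennreal (v * exp (- y i) / 16)" using x by (auto simp: bad1_def)
    qed
    also have "\<dots> = ennreal (v / 16 * (\<Sum>i=k..<k + (I - k). exp (- y i)))"
      using pos by (subst sum_ennreal) (auto simp: v_def sum_distrib_left)
    also have "\<dots> \<le> ennreal (v / 16 * (1.05 * exp (- y k)))"
      using pos sum_exp_quadrupling_le[of y, OF y_Suc y16[OF k]]
      by (intro ennreal_leI mult_left_mono) (auto simp: v_def)
    also have "\<dots> = ennreal (1.05 * exp (- y k)) * (ennreal (v / 16))"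
      using pos by (simp add: ennreal_mult[symmetric] v_def mult.commute)
    also have "\<dots> \<le> ennreal (1.05 * exp (- y k)) * evidence n S x"
    proof (rule mult_left_mono)
      show "ennreal (v / 16) \<le> evidence n S x"
      proof (cases "evidence n S x")
        case (real e)
        then show ?thesis using low
          by (simp add: ennreal_mult[symmetric] ennreal_less_iff v_def flip: ennreal_numeral)
      qed simp
    qed simp
    finally show ?thesis using \<open>0 < evidence n S x\<close> by blast
  qed
  ultimately show thesis using that[of bad] by (simp add: bad_def)
qed

lemma likelihood_eq_ratio:
  assumes x: "\<And>i. i < n \<Longrightarrow> x i \<in> space \<mu>" "\<And>i. i < n \<Longrightarrow> f s (x i) \<noteq> 0" and t: "t \<in> S"
  shows "ennreal (likelihood f n x t) = ennreal (likelihood f n x s) * sample_ratio n x t"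
proof -
  have "sample_ratio n x t = ennreal (\<Prod>i<n. f t (x i) / f s (x i))"
    unfolding sample_ratio_def likelihood_ratio_def
    using x t s density_nonneg by (intro prod_ennreal) auto
  moreover have "likelihood f n x t = likelihood f n x s * (\<Prod>i<n. f t (x i) / f s (x i))"
    unfolding likelihood_def prod.distrib[symmetric] using x by (intro prod.cong) auto
  moreover have "0 \<le> likelihood f n x s" "0 \<le> (\<Prod>i<n. f t (x i) / f s (x i))"
    unfolding likelihood_def using x s t density_nonneg by (auto intro!: prod_nonneg)
  ultimately show ?thesis by (simp add: ennreal_mult)
qed

text \<open>Numerator and denominator of Bayes' formula are evidences multiplied by the positive likelihood at \<open>s\<close>; in
particular the denominator is positive and finite.\<close>

lemma posterior_ge:
  assumes z: "z \<in> space (sample_law n)" and pos: "\<And>i. i < n \<Longrightarrow> f s (z i) \<noteq> 0"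
    and A [measurable]: "A \<in> sets \<nu>"
    and ev: "0 < evidence n S z" "evidence n S z < \<top>"
    and small: "evidence n (S - A) z \<le> ennreal \<delta> * evidence n S z" and \<delta>: "0 \<le> \<delta>"
  shows "1 - \<delta> \<le> posterior \<pi>\<^sub>0 \<nu> f n z A"
proof -
  note [measurable] = measurable_sample_ratio_snd[OF z]
  have zi: "z i \<in> space \<mu>" if "i < n" for i
    using z that by (auto simp: sample_law_def space_PiM PiE_def Pi_iff)
  define L where "L = likelihood f n z s"
  have "0 \<le> L" "L \<noteq> 0"
    using pos zi s density_nonneg by (auto simp: L_def likelihood_def intro!: prod_nonneg)
  then have L: "0 < L" by simp
  have int: "(\<integral>\<^sup>+t\<in>B. ennreal (likelihood f n z t) \<partial>\<nu>) = ennreal L * evidence n B z"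
    if [measurable]: "B \<in> sets \<nu>" for B
  proof -
    have "(\<integral>\<^sup>+t\<in>B. ennreal (likelihood f n z t) \<partial>\<nu>)
        = (\<integral>\<^sup>+t. ennreal L * (sample_ratio n z t * indicator B t) \<partial>\<nu>)"
      using likelihood_eq_ratio[of n z] zi pos
      by (intro nn_integral_cong) (simp add: L_def mult.assoc)
    also have "\<dots> = ennreal L * evidence n B z"
      unfolding evidence_def by (rule nn_integral_cmult) measurable
    finally show ?thesis .
  qed
  obtain e where e: "evidence n S z = ennreal e" "0 < e"
    using ev by (cases "evidence n S z") auto
  have A_sub: "A \<subseteq> S" using sets.sets_into_space[OF A] by simp
  have split: "evidence n S z = evidence n A z + evidence n (S - A) z"
    unfolding evidence_def using A_sub
    by (subst nn_integral_add[symmetric])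
       (auto intro!: nn_integral_cong simp: indicator_def)
  then obtain a b where ab: "evidence n A z = ennreal a" "0 \<le> a" "evidence n (S - A) z = ennreal b" "0 \<le> b"
    using ev(2) by (cases "evidence n A z"; cases "evidence n (S - A) z") auto
  have "e = a + b" using split ab e by (simp flip: ennreal_plus)
  moreover have "b \<le> \<delta> * e" using small ab e \<delta> by (simp add: ennreal_mult[symmetric])
  ultimately have ratio: "1 - \<delta> \<le> a / e" using e by (simp add: field_simps)
  have "posterior \<pi>\<^sub>0 \<nu> f n z A = enn2real (ennreal (L * a) / ennreal (L * e))"
    unfolding posterior_def Let_def using L e ab
    by (simp add: int ennreal_mult[symmetric])
  also have "\<dots> = a / e" using L e ab by (simp add: divide_ennreal)
  finally show ?thesis using ratio by simp
qed

lemma measurable_posterior [measurable]: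
  assumes A [measurable]: "A \<in> sets \<nu>"
  shows "(\<lambda>z. posterior \<pi>\<^sub>0 \<nu> f n z A) \<in> borel_measurable (sample_law n)"
proof -
  have "(\<lambda>z. f (snd z) (fst z i)) \<in> borel_measurable (sample_law n \<Otimes>\<^sub>M \<nu>)" if "i < n" for i
    using measurable_compose[OF measurable_sample_component[OF that] measurable_density_prior] by simp
  then have [measurable]: "(\<lambda>(z, t). likelihood f n z t) \<in> borel_measurable (sample_law n \<Otimes>\<^sub>M \<nu>)"
    unfolding likelihood_def case_prod_unfold by (intro borel_measurable_prod) auto
  show ?thesis unfolding posterior_def Let_def by measurable
qed

text \<open>The evidence of the whole parameter set is finite almost surely because its expectation is at most one.\<close>

lemma AE_sample_regular:
  "AE z in sample_law n. (\<forall>i<n. f s (z i) \<noteq> 0) \<and> evidence n S z < \<top>"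
proof -
  have "AE y in model \<mu> f s. f s y \<noteq> 0"
    unfolding model_def by (subst AE_density) auto
  then have "AE z in sample_law n. f s (z i) \<noteq> 0" if "i < n" for i
    unfolding sample_law_def using that by (intro AE_PiM_component) (auto intro: centre.prob_space_axioms)
  then have "AE z in sample_law n. \<forall>i\<in>{..<n}. f s (z i) \<noteq> 0"
    by (intro AE_finite_allI) auto
  moreover have "AE z in sample_law n. evidence n S z \<noteq> \<infinity>"
    using evidence_integral_le[of S n] prior.emeasure_space_1
    by (intro nn_integral_PInf_AE) (auto simp: top_unique)
  ultimately show ?thesis by eventually_elim (auto simp: less_top)
qed

end

lemma dyadic_below:
  fixes a :: real
  assumes "0 < a" "a \<le> 1"
  obtains j :: nat where "1 / 2 ^ j \<le> a" "a < 2 / 2 ^ j"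
proof -
  obtain k where "1 / a < 2 ^ k" using real_arch_pow[of 2 "1 / a"] by auto
  then have ex: "1 / 2 ^ k \<le> a" using assms by (simp add: field_simps)
  define j where "j = (LEAST j. 1 / 2 ^ j \<le> a)"
  have j: "1 / 2 ^ j \<le> a" unfolding j_def by (rule LeastI, rule ex)
  have "a < 2 / 2 ^ j"
  proof (cases j)
    case (Suc i)
    have "\<not> 1 / 2 ^ i \<le> a" using not_less_Least[of i "\<lambda>j. 1 / 2 ^ j \<le> a"] Suc by (auto simp: j_def)
    then show ?thesis using Suc by simp
  qed (use assms in simp)
  with j show thesis by (rule that)
qed

theorem theorem2:
  fixes \<mu> P :: "'x measure" and S :: "'t set" and f :: "'t \<Rightarrow> 'x \<Rightarrow> real"
    and \<nu> \<pi>\<^sub>0 :: "'t measure" and s :: 't and n :: nat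
    and D :: "real \<Rightarrow> real" and \<beta> :: "nat \<Rightarrow> real"
    and \<gamma> c \<kappa> Dbar \<beta>bar :: real
  assumes density_nonneg: "\<And>t x. t \<in> S \<Longrightarrow> x \<in> space \<mu> \<Longrightarrow> 0 \<le> f t x"
    and density_measurable:
      "(\<lambda>(x, t). f t x) \<in> borel_measurable (\<mu> \<Otimes>\<^sub>M metric_borel S (hdist \<mu> f))"
    and model_prob: "\<And>t. t \<in> S \<Longrightarrow> prob_space (model \<mu> f t)"
    and model_inj: "inj_on (model \<mu> f) S"
    and prior: "prob_space \<nu>" "sets \<nu> = sets (metric_borel S (hdist \<mu> f))"
    and default: "prob_space \<pi>\<^sub>0" "sets \<pi>\<^sub>0 = sets (metric_borel S (hdist \<mu> f))"
    and truth: "prob_space P" "sets P = sets \<mu>"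
    and s: "s \<in> S"
    and D_mono: "antimono_on {0<..1/4} D"
    and D_ge_1: "\<And>x. x \<in> {0<..1/4} \<Longrightarrow> 1 \<le> D x"
    and D_entropy: "\<And>x b N. x \<in> {0<..1/4} \<Longrightarrow> b \<in> S
        \<Longrightarrow> N \<subseteq> Metric_space.mcball S (hdist \<mu> f) b (4 * x) \<Longrightarrow> separated (hdist \<mu> f) x N
        \<Longrightarrow> finite N \<and> real (card N) \<le> exp (D x)"
    and D_bdd: "bdd_above (D ` {0<..1/4})"
    and Dbar: "Dbar = (SUP x\<in>{0<..1/4}. D x)"
    and \<beta>_mono: "mono \<beta>"
    and \<beta>_ge_1: "\<And>j. 1 \<le> \<beta> j"
    and \<gamma>: "1 \<le> \<gamma>" "\<gamma> < 4"
    and prior_balls: "\<And>j k. 3 \<le> j \<Longrightarrow> 3 \<le> k \<Longrightarrow> k \<le> j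
        \<Longrightarrow> measure \<nu> (Metric_space.mcball S (hdist \<mu> f) s (1 / 2 ^ (j - k)))
          \<le> exp (\<gamma> ^ k * \<beta> j) * measure \<nu> (Metric_space.mcball S (hdist \<mu> f) s (1 / 2 ^ j))"
    and \<beta>_bdd: "bdd_above (\<beta> ` {3..})"
    and \<beta>bar: "\<beta>bar = (SUP j\<in>{3..}. \<beta> j)"
    and c: "0 < c" "c \<le> 1 / 2"
    and n: "real n \<ge> 4 ^ 4 *
        Max {(16 * real n / c\<^sup>2) powr (ln \<gamma> / ln 4) * \<beta>bar / 3, Dbar, ln (8 / c)}"
    and \<kappa>: "hellinger (model \<mu> f s) P = \<kappa> / sqrt (2 * real n)" "0 \<le> \<kappa>" "\<kappa> < 1 / 2"
  shows "\<P>(x in (\<Pi>\<^sub>M i\<in>{..<n}. P). \<forall>k\<ge>J\<^sub>2 \<gamma> \<beta>bar Dbar c.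
            posterior \<pi>\<^sub>0 \<nu> f n x (Metric_space.mcball S (hdist \<mu> f) s (2 ^ k * c / sqrt (real n)))
              \<ge> 1 - 1.05 * exp (- (4 powr (real k - 4) * c\<^sup>2)))
         \<ge> 1 - (\<kappa> + c)"
proof -
  interpret bayes_model \<mu> S f \<nu> s
    using density_nonneg density_measurable model_prob model_inj prior s
    by (intro bayes_model.intro statistical_model.intro bayes_model_axioms.intro) auto
  define J where "J = J\<^sub>2 \<gamma> \<beta>bar Dbar c"
  define y where "y = (\<lambda>i::nat. 4 powr (real i - 4) * c\<^sup>2)"
  define r where "r = (\<lambda>i::nat. 2 ^ i * c / sqrt (real n))"
  have D_le: "D x \<le> Dbar" if "x \<in> {0<..1/4}" for x
    unfolding Dbar by (rule cSUP_upper[OF that D_bdd])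
  have Dbar1: "1 \<le> Dbar" using D_ge_1[of "1/4"] D_le[of "1/4"] by simp
  have \<beta>_le: "\<beta> j \<le> \<beta>bar" if "3 \<le> j" for j
    unfolding \<beta>bar using that by (intro cSUP_upper[OF _ \<beta>_bdd]) simp
  have \<beta>bar1: "1 \<le> \<beta>bar" using \<beta>_ge_1[of 3] \<beta>_le[of 3] by simp
  have n256: "256 \<le> real n"
  proof -
    have "Dbar \<le> Max {(16 * real n / c\<^sup>2) powr (ln \<gamma> / ln 4) * \<beta>bar / 3, Dbar, ln (8 / c)}" by simp
    with Dbar1 have "1 \<le> Max {(16 * real n / c\<^sup>2) powr (ln \<gamma> / ln 4) * \<beta>bar / 3, Dbar, ln (8 / c)}"
      by (rule order_trans)
    then have "4 ^ 4 * 1 \<le> real n" by (intro order_trans[OF mult_left_mono n]) auto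
    then show ?thesis by simp
  qed
  then have n0: "0 < n" by simp
  have \<beta>bar0: "0 \<le> \<beta>bar" and Dbar0: "0 \<le> Dbar" and c8: "c \<le> 8" using \<beta>bar1 Dbar1 c by auto
  note threshold = threshold_persists[OF \<gamma> \<beta>bar0 Dbar0 c(1) c8, folded J_def]
  have thr: "\<And>i. J \<le> i \<Longrightarrow> \<gamma> ^ (i + 2) * \<beta>bar / 3 \<le> y i"
    "\<And>i. J \<le> i \<Longrightarrow> Dbar \<le> y i" "\<And>i. J \<le> i \<Longrightarrow> ln (8 / c) \<le> y i"
    using threshold by (auto simp: y_def)
  have sqrt_n: "16 \<le> sqrt (real n)" by (rule real_le_rsqrt) (use n256 in simp)
  define a where "a = c / (2 * sqrt (real n))"
  have a0: "0 < a" using c n0 by (simp add: a_def)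
  have "a \<le> (1 / 2) / (2 * 16)"
    unfolding a_def using c sqrt_n by (intro frac_le) auto
  then have a64: "a \<le> 1 / 64" by simp
  \<comment> \<open>The ball of radius \<open>1 / 2 ^ j\<close> provides the lower bound for the denominator.\<close>
  obtain j where j: "1 / 2 ^ j \<le> a" "a < 2 / 2 ^ j"
    using dyadic_below[of a] a0 a64 by auto
  have j3: "3 \<le> j"
  proof (rule ccontr)
    assume "\<not> 3 \<le> j"
    then have "(2::real) ^ j \<le> 2 ^ 2" by (intro power_increasing) auto
    then have "1 / 4 \<le> (1::real) / 2 ^ j" by (simp add: field_simps)
    then show False using j(1) a64 by linarith
  qed
  define v where "v = measure \<nu> (mcball s (1 / 2 ^ j))"
  have ball1: "mcball s r = S" if "1 \<le> r" for r
    using order_trans[OF hellinger_affinity_model(2)[OF s] that] s by auto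
  have prior1: "measure \<nu> S = 1" using prior.prob_space by simp
  have dbl: "measure \<nu> (mcball s (1 / 2 ^ (j - k))) \<le> exp (\<gamma> ^ k * \<beta>bar) * v" if "3 \<le> k" "k \<le> j" for k
  proof -
    have "exp (\<gamma> ^ k * \<beta> j) * v \<le> exp (\<gamma> ^ k * \<beta>bar) * v"
      using \<beta>_le[OF j3] \<gamma> by (intro mult_right_mono) (auto simp: v_def intro!: mult_left_mono)
    with prior_balls[OF j3 that] show ?thesis by (simp add: v_def)
  qed
  have v0: "0 < v"
    using dbl[OF j3 order_refl] ball1[of 1] prior1 by (cases "v = 0") (auto simp: v_def zero_less_measure_iff)
  have mass: "measure \<nu> (mcball s (r (Suc i))) \<le> exp (12 * y i) * v" if i: "J \<le> i" for i
  proof -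
    \<comment> \<open>The ball of radius \<open>r (Suc i)\<close> is within \<open>i + 3\<close> doublings of the small one; when there are fewer than
       \<open>i + 3\<close> doublings up to radius one, \<open>j\<close> of them already give the whole of \<open>S\<close>.\<close>
    define k where "k = min (i + 3) j"
    have k: "3 \<le> k" "k \<le> j" using j3 by (auto simp: k_def)
    have "measure \<nu> (mcball s (r (Suc i))) \<le> measure \<nu> (mcball s (1 / 2 ^ (j - k)))"
    proof (cases "i + 3 \<le> j")
      case True
      then have "(2::real) ^ j = 2 ^ (j - k) * 2 ^ (i + 3)"
        by (simp add: k_def flip: power_add)
      moreover have "r (Suc i) = 2 ^ (i + 2) * a" by (simp add: r_def a_def)
      ultimately have "r (Suc i) \<le> 1 / 2 ^ (j - k)" using j(2) by (simp add: field_simps power_add)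
      then show ?thesis by (intro prior.finite_measure_mono) auto
    next
      case False
      then have "mcball s (1 / 2 ^ (j - k)) = S" by (intro ball1) (simp add: k_def)
      then show ?thesis using prior.prob_le_1 prior1 by simp
    qed
    also have "\<dots> \<le> exp (\<gamma> ^ k * \<beta>bar) * v" by (rule dbl[OF k])
    also have "\<gamma> ^ k * \<beta>bar \<le> 12 * y i"
    proof -
      have "\<gamma> ^ k \<le> \<gamma> ^ (i + 3)" using \<gamma> by (intro power_increasing) (auto simp: k_def)
      also have "\<dots> = \<gamma> * \<gamma> ^ (i + 2)" by (simp add: power_add power3_eq_cube power2_eq_square)
      also have "\<dots> \<le> 4 * \<gamma> ^ (i + 2)" using \<gamma> by (intro mult_right_mono) auto
      finally have "\<gamma> ^ k * \<beta>bar \<le> 4 * \<gamma> ^ (i + 2) * \<beta>bar" using \<beta>bar1 by (intro mult_right_mono) auto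
      then show ?thesis using thr(1)[OF i] by simp
    qed
    finally show ?thesis using v0 by simp
  qed
  have entropy: "finite N \<and> real (card N) \<le> exp (y i)"
    if i: "J \<le> i" and N: "N \<subseteq> mcball s (r (Suc i))" "separated (hdist \<mu> f) (min (r i / 2) (1 / 4)) N" for i N
  proof -
    let ?x = "min (r i / 2) (1 / 4)"
    have x: "?x \<in> {0<..1/4}" using c n0 by (simp add: r_def)
    have "N \<subseteq> mcball s (4 * ?x)"
    proof
      fix t assume "t \<in> N"
      then have t: "t \<in> S" "hdist \<mu> f s t \<le> r (Suc i)" using N by auto
      then show "t \<in> mcball s (4 * ?x)" using s hellinger_affinity_model(2)[OF s t(1)] by (simp add: r_def min_def ac_simps)
    qed
    from D_entropy[OF x s this N(2)] have "finite N" "real (card N) \<le> exp (D ?x)" by auto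
    moreover have "D ?x \<le> y i" using D_le[OF x] thr(2)[OF i] by simp
    ultimately show ?thesis using order_trans exp_le_cancel_iff by blast
  qed
  obtain bad where bad: "bad \<in> sets (sample_law n)" "measure (sample_law n) bad \<le> c"
    and good: "\<And>x k. x \<in> space (sample_law n) - bad \<Longrightarrow> J \<le> k \<Longrightarrow> 0 < evidence n S x \<and>
      evidence n (S - mcball s (r k)) x \<le> ennreal (1.05 * exp (- y k)) * evidence n S x"
    by (rule evidence_concentration[of n c J "1 / 2 ^ j"])
       (use n0 c thr(3) j mass entropy v0 in \<open>auto simp: r_def y_def a_def v_def\<close>)
  define G where "G = {x \<in> space (sample_law n). \<forall>k\<ge>J. posterior \<pi>\<^sub>0 \<nu> f n x (mcball s (r k)) \<ge> 1 - 1.05 * exp (- y k)}"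
  have G [measurable]: "G \<in> sets (sample_law n)" unfolding G_def by measurable
  interpret X: prob_space "sample_law n" by (rule prob_space_sample_law)
  have "1 - c \<le> measure (sample_law n) (space (sample_law n) - bad)"
    using X.prob_compl[OF bad(1)] bad(2) by simp
  also have "\<dots> \<le> measure (sample_law n) G"
  proof (rule X.finite_measure_mono_AE)
    show "AE x in sample_law n. x \<in> space (sample_law n) - bad \<longrightarrow> x \<in> G"
      using AE_sample_regular[of n]
    proof eventually_elim
      case (elim x)
      show ?case
      proof
        assume x: "x \<in> space (sample_law n) - bad"
        have "1 - 1.05 * exp (- y k) \<le> posterior \<pi>\<^sub>0 \<nu> f n x (mcball s (r k))" if "J \<le> k" for k
          by (rule posterior_ge) (use x elim good[OF x that] in auto)
        then show "x \<in> G" using x by (simp add: G_def)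
      qed
    qed
  qed measurable
  finally have model_good: "1 - c \<le> measure (sample_law n) G" .
  have "\<bar>measure (sample_law n) G - measure (\<Pi>\<^sub>M i\<in>{..<n}. P) G\<bar> \<le> sqrt (2 * real n) * hellinger (model \<mu> f s) P"
    unfolding sample_law_def
    by (rule product_measure_TV_le)
       (use truth G in \<open>auto simp: sample_law_def centre.prob_space_axioms\<close>)
  also have "\<dots> = \<kappa>" using n0 by (simp add: \<kappa>(1))
  finally have "1 - (\<kappa> + c) \<le> measure (\<Pi>\<^sub>M i\<in>{..<n}. P) G" using model_good by linarith
  moreover have "space (sample_law n) = space (\<Pi>\<^sub>M i\<in>{..<n}. P)"
    using sets_eq_imp_space_eq[OF truth(2)] by (simp add: sample_law_def space_PiM)
  ultimately show ?thesis by (simp add: G_def J_def r_def y_def)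
qed

end
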